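(* Let $W$ be a binary memoryless symmetric (BMS) channel with symmetric capacity $I(W)$. Consider the sequence of polar codes $\{\mathcal C^m\}$ of rate $R=I(W)$ with increasing block lengths $n=2^m$, such that the set of frozen symbols of $\mathcal C^m$ contains the $2^m(1-I(W))$ indices (rounded to an integer if necessary) that have the largest SC decoding error probabilities. Then the codes $\mathcal C^m$ cannot be invariant under $BLTA(\mathbf s,m)$ such that there exists a diagonal block of size $s_i$ that is an increasing function of $m$. That is, there do not exist, for $m=1,2,\dots$, vectors $\mathbf s^{(m)}=(s^{(m)}_0,\dots,s^{(m)}_{l_m-1})$ of positive integers with $\sum_i s^{(m)}_i=m$ and indices $i_m\in\{0,\dots,l_m-1\}$ such that $\mathcal C^m$ is invariant under every permutation in $BLTA(\mathbf s^{(m)},m)$ for every $m$, and $s^{(m)}_{i_m}$, as a function of $m$, is increasing (in the sense of growing with $m$: non-decreasing and unbounded).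
   Context: **Polar codes.** Write $[n]=\{0,\dots,n-1\}$, $n=2^m$. Let $\mathbf A_m=\begin{pmatrix}1&0\\1&1\end{pmatrix}^{\otimes m}$ over $\mathbb F_2$. The polar code with set of frozen symbols $\mathcal F\subseteq[n]$ is the binary linear code of length $n$ spanned by the rows of $\mathbf A_m$ with indices in $[n]\setminus\mathcal F$. **Channels.** A BMS channel $W$ has input alphabet $\{0,1\}$ and transition probabilities $W(y|u)$, with an involution $y\mapsto\bar y$ of the output alphabet such that $W(y|0)=W(\bar y|1)$. $I(W)$ is the mutual information between a uniform input and the output, in bits. The channel transformations are $$W^{(-)}(y_0,y_1|u_0)=\tfrac12\sum_{u_1\in\{0,1\}}W(y_0|u_0\oplus u_1)W(y_1|u_1),$$ $$W^{(+)}(y_0,y_1,u_0|u_1)=\tfrac12 W(y_0|u_0\oplus u_1)W(y_1|u_1).$$ For $i\in[2^m]$, the synthetic channel $W^{(i)}$ is obtained from $W$ by applying $m$ such transformations successively: reading the $m$ bits of $i$ from the most significant to the least significant one, apply $(-)$ for a bit $0$ and $(+)$ for a bit $1$. The SC (successive cancellation) decoding error probability of index $i$ is the probability of error of the maximum-likelihood decision on the uniformly distributed input of $W^{(i)}$, i.e. $\frac12\sum_z\min\{W^{(i)}(z|0),W^{(i)}(z|1)\}$ (with an integral for continuous outputs). Ties between indices may be broken arbitrarily. **Affine permutations.** Identify $[2^m]$ with $\mathbb F_2^m$ by representing an integer as the column vector of its $m$ bits, listed from the least significant (first entry) to the most significant (last entry). An affine permutation of $[2^m]$ is a map $\pi:\mathbf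 x\mapsto\mathbf A\mathbf x+\mathbf b$ with $\mathbf A\in\mathbb F_2^{m\times m}$ invertible and $\mathbf b\in\mathbb F_2^m$. A code $\mathcal C$ of length $n$ is invariant under a permutation $\pi$ of $[n]$ if $(c_{\pi(0)},\dots,c_{\pi(n-1)})\in\mathcal C$ for every $(c_0,\dots,c_{n-1})\in\mathcal C$. **$BLTA(\mathbf s,m)$.** For $\mathbf s=(s_0,\dots,s_{l-1})$ with positive integer entries and $\sum_i s_i=m$, the block lower-triangular affine group $BLTA(\mathbf s,m)$ is the group of all affine permutations $\mathbf x\mapsto\mathbf A\mathbf x+\mathbf b$ where $\mathbf b\in\mathbb F_2^m$ is arbitrary and $\mathbf A$ is invertible and block lower-triangular, $\mathbf A=(\mathbf A_{i,j})_{0\le i,j<l}$ with $\mathbf A_{i,j}$ of size $s_i\times s_j$ and $\mathbf A_{i,j}=\mathbf 0$ for $j>i$. The integers $s_i$ are the sizes of the diagonal blocks.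
   Formalization: The formal theorem additionally assumes 0 < I(W) < 1; for I(W) = 1 nothing is frozen and for I(W) = 0 everything is, so the codes are invariant under all permutations and s = (m) would refute the claim. *)

theory Defs
  imports
    "HOL-Probability.Information"
    "HOL-Library.Z2"
    "Jordan_Normal_Form.VS_Connect"
begin

text \<open>
  A channel carries a reference measure on its output alphabet, and \<open>tprob W u y\<close> is
  \<open>W(y|u)\<close>, the density of the output with respect to that measure given the input \<open>u\<close>.
  A discrete channel has a counting measure as its reference measure (so that
  \<open>tprob W u y\<close> is a probability), a channel with real outputs typically has \<open>lborel\<close>.
\<close>

record 'y channel =
  outs :: "'y measure"
  tprob :: "bit \<Rightarrow> 'y \<Rightarrow> real"

text \<open>
  The involution has to preserve the reference measure: for densities, \<open>W(y|0) = W(ybar|1)\<close>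
  expresses the symmetry of the channel only under this condition. For counting measures it
  holds for every involution.
\<close>

definition bms_channel :: "'y channel \<Rightarrow> bool" where
  "bms_channel W \<longleftrightarrow>
     sigma_finite_measure (outs W) \<and>
     (\<forall>u. tprob W u \<in> borel_measurable (outs W)) \<and>
     (\<forall>u. \<forall>y\<in>space (outs W). 0 \<le> tprob W u y) \<and>
     (\<forall>u. (\<integral>\<^sup>+ y. ennreal (tprob W u y) \<partial>outs W) = 1) \<and>
     (\<exists>bar. bar \<in> measurable (outs W) (outs W) \<and>
            distr (outs W) (outs W) bar = outs W \<and>
            (\<forall>y\<in>space (outs W). bar (bar y) = y \<and> tprob W 0 y = tprob W 1 (bar y)))"

text \<open>The law of (input, output) for a uniformly distributed input.\<close>

definition joint_law :: "'y channel \<Rightarrow> (bit \<times> 'y) measure" where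
  "joint_law W =
     density (count_space UNIV \<Otimes>\<^sub>M outs W) (\<lambda>(u, y). ennreal (1/2 * tprob W u y))"

definition capacity :: "'y channel \<Rightarrow> real" where
  "capacity W =
     prob_space.mutual_information (joint_law W) 2 (count_space UNIV) (outs W) fst snd"

definition ml_error :: "'y channel \<Rightarrow> real" where
  "ml_error W = 1/2 * (\<integral>z. min (tprob W 0 z) (tprob W 1 z) \<partial>outs W)"

definition chan_minus :: "'y channel \<Rightarrow> ('y \<times> 'y) channel" where
  "chan_minus W =
     \<lparr> outs = outs W \<Otimes>\<^sub>M outs W,
       tprob = (\<lambda>u0 (y0, y1). 1/2 * (\<Sum>u1\<in>UNIV. tprob W (u0 + u1) y0 * tprob W u1 y1)) \<rparr>"

definition chan_plus :: "'y channel \<Rightarrow> ('y \<times> 'y \<times> bit) channel" where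
  "chan_plus W =
     \<lparr> outs = outs W \<Otimes>\<^sub>M (outs W \<Otimes>\<^sub>M count_space UNIV),
       tprob = (\<lambda>u1 (y0, y1, u0). 1/2 * (tprob W (u0 + u1) y0 * tprob W u1 y1)) \<rparr>"

text \<open>
  Each transformation changes the type of the outputs, whereas the synthetic channels are
  defined by recursion on the number of transformations. Their outputs are therefore
  represented by trees: \<open>relabel f\<close> renames the outputs along an injection \<open>f\<close>.
\<close>

datatype 'y obs =
    Leaf 'y
  | MinusOut "'y obs" "'y obs"
  | PlusOut "'y obs" "'y obs" bit

definition relabel :: "('a \<Rightarrow> 'b) \<Rightarrow> 'a channel \<Rightarrow> 'b channel" where
  "relabel f V = \<lparr> outs = embed_measure (outs V) f, tprob = (\<lambda>u z. tprob V u (inv_into UNIV f z)) \<rparr>"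

text \<open>
  \<open>synth W m i\<close> is the synthetic channel of index \<open>i < 2 ^ m\<close>. The least significant bit
  of \<open>i\<close> selects the transformation that is applied last.
\<close>

primrec synth :: "'y channel \<Rightarrow> nat \<Rightarrow> nat \<Rightarrow> 'y obs channel" where
  "synth W 0 i = relabel Leaf W"
| "synth W (Suc m) i =
     (if even i
      then relabel (\<lambda>(y0, y1). MinusOut y0 y1) (chan_minus (synth W m (i div 2)))
      else relabel (\<lambda>(y0, y1, u0). PlusOut y0 y1 u0) (chan_plus (synth W m (i div 2))))"

definition sc_error :: "'y channel \<Rightarrow> nat \<Rightarrow> nat \<Rightarrow> real" where
  "sc_error W m i = ml_error (synth W m i)"

definition kronecker :: "'a::semiring_1 mat \<Rightarrow> 'a mat \<Rightarrow> 'a mat" where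
  "kronecker A B =
     mat (dim_row A * dim_row B) (dim_col A * dim_col B)
       (\<lambda>(i, j). A $$ (i div dim_row B, j div dim_col B) * B $$ (i mod dim_row B, j mod dim_col B))"

primrec polar_mat :: "nat \<Rightarrow> bit mat" where
  "polar_mat 0 = 1\<^sub>m 1"
| "polar_mat (Suc m) = kronecker (mat_of_rows_list 2 [[1, 0], [1, 1]]) (polar_mat m)"

definition polar_code :: "nat \<Rightarrow> nat set \<Rightarrow> bit vec set" where
  "polar_code m F = LinearCombinations.module.span class_ring (module_vec TYPE(bit) (2 ^ m))
     {row (polar_mat m) i | i. i \<in> {..<2 ^ m} - F}"

text \<open>
  \<open>F\<close> consists of \<open>2 ^ m * (1 - I(W))\<close> indices, rounded in either direction, with the largest
  SC decoding error probabilities. Ties are broken arbitrarily, so \<open>F\<close> need not be unique.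
\<close>

definition polar_frozen_set :: "'y channel \<Rightarrow> nat \<Rightarrow> nat set \<Rightarrow> bool" where
  "polar_frozen_set W m F \<longleftrightarrow>
     F \<subseteq> {..<2 ^ m} \<and>
     int (card F) \<in> {\<lfloor>2 ^ m * (1 - capacity W)\<rfloor>, \<lceil>2 ^ m * (1 - capacity W)\<rceil>} \<and>
     (\<forall>i\<in>F. \<forall>j\<in>{..<2 ^ m} - F. sc_error W m j \<le> sc_error W m i)"

text \<open>Least significant bit first; \<open>of_nat\<close> into the field \<open>bit\<close> is reduction modulo 2.\<close>

definition bits_of_nat :: "nat \<Rightarrow> nat \<Rightarrow> bit vec" where
  "bits_of_nat m i = vec m (\<lambda>k. of_nat (i div 2 ^ k))"

definition nat_of_bits :: "bit vec \<Rightarrow> nat" where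
  "nat_of_bits x = (\<Sum>k<dim_vec x. if x $ k = 1 then 2 ^ k else 0)"

definition affine_map :: "nat \<Rightarrow> bit mat \<Rightarrow> bit vec \<Rightarrow> nat \<Rightarrow> nat" where
  "affine_map m A b i = nat_of_bits (A *\<^sub>v bits_of_nat m i + b)"

text \<open>The rows (or columns) of the block with index \<open>p\<close>, for blocks of sizes \<open>s\<close>.\<close>

definition block_range :: "nat list \<Rightarrow> nat \<Rightarrow> nat set" where
  "block_range s p = {sum_list (take p s) ..< sum_list (take (Suc p) s)}"

definition block_lower_triangular :: "nat list \<Rightarrow> bit mat \<Rightarrow> bool" where
  "block_lower_triangular s A \<longleftrightarrow>
     (\<forall>q<length s. \<forall>p<q. \<forall>r\<in>block_range s p. \<forall>c\<in>block_range s q. A $$ (r, c) = 0)"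

definition BLTA :: "nat list \<Rightarrow> nat \<Rightarrow> (nat \<Rightarrow> nat) set" where
  "BLTA s m =
     {affine_map m A b | A b. A \<in> carrier_mat m m \<and> invertible_mat A \<and>
        block_lower_triangular s A \<and> b \<in> carrier_vec m}"

definition code_invariant :: "nat \<Rightarrow> bit vec set \<Rightarrow> (nat \<Rightarrow> nat) \<Rightarrow> bool" where
  "code_invariant n C \<pi> \<longleftrightarrow> (\<forall>c\<in>C. vec n (\<lambda>j. c $ \<pi> j) \<in> C)"

end

theory Submission
  imports Defs
begin

text \<open>
  Let \<open>Z\<close>, \<open>T\<close> and \<open>H\<close> be the Bhattacharyya parameter, the total variation distance
  \<open>1 - 2 P\<^sub>e\<close> and the conditional entropy of a synthetic channel. A minus step squares \<open>T\<close> and at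
  most doubles \<open>Z\<close>, a plus step squares \<open>Z\<close> and at most doubles \<open>T\<close>, and the average of \<open>H\<close> is
  preserved.

  Up to rounding, the number of frozen indices is the sum of all \<open>H\<close>, so the total of \<open>1 - H\<close> over the frozen
  indices balances the total of \<open>H\<close> over the others. If the threshold of the error probability
  that separates the frozen indices were close to 0 or to 1/2, one side would consist of
  nearly polarized channels only. For infinitely many \<open>m\<close> this is impossible: the potential
  \<open>\<Sum>(Z T)\<^sup>a\<close> grows by a factor of at most about \<open>4\<^sup>a\<close> per level on nearly polarized channels,
  whereas the number of unpolarized channels grows like \<open>2\<^bsup>m/r\<^esup>\<close> for a fixed \<open>r\<close>, so for small \<open>a\<close>
  unpolarized channels carry a fixed fraction of the potential infinitely often. Hence the
  threshold is bounded away from 0 and 1/2 for infinitely many \<open>m\<close>.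

  Invariance under BLTA forces the frozen set to be symmetric under permutations of the bits in
  the growing block. Start from an unpolarized prefix: \<open>k\<close> plus steps followed by \<open>k\<close> minus steps
  give an almost perfect channel, the opposite order gives an almost useless one. As the average
  of \<open>H\<close> is preserved, most suffixes of the first are not frozen and most suffixes of the second
  are, although the two differ by a permutation of bits in the block.
\<close>

section \<open>Polarization of abstract channel parameters\<close>

locale polarization =
  fixes H Z T :: "nat \<Rightarrow> nat \<Rightarrow> real"
  assumes T_minus: "T (Suc m) (2 * i) = (T m i)\<^sup>2"
    and T_plus_le: "T (Suc m) (Suc (2 * i)) \<le> 2 * T m i"
    and T_plus_ge: "T m i \<le> T (Suc m) (Suc (2 * i))"
    and Z_plus: "Z (Suc m) (Suc (2 * i)) = (Z m i)\<^sup>2"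
    and Z_minus_le: "Z (Suc m) (2 * i) \<le> 2 * Z m i"
    and Z_minus_ge: "Z m i \<le> Z (Suc m) (2 * i)"
    and H_split: "H (Suc m) (2 * i) + H (Suc m) (Suc (2 * i)) = 2 * H m i"
    and Z_nonneg: "0 \<le> Z m i"
    and T_nonneg: "0 \<le> T m i"
    and T_Z_ge_1: "1 \<le> T m i + Z m i"
    and H_ge: "1 - T m i \<le> H m i"
    and H_le: "H m i \<le> 3 * Z m i"
    and H_le': "2 * H m i \<le> 1 + Z m i"
    and Z_le: "Z m i \<le> 1 - (T m i)\<^sup>2 / 2"
    and T_le: "T m i \<le> 1 - (Z m i)\<^sup>2 / 2"
    and Z_root: "0 < Z 0 0"
    and T_root: "0 < T 0 0"
begin

lemma Z_le_1: "Z m i \<le> 1"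
  using Z_le[of m i] zero_le_power2[of "T m i"] by linarith

lemma T_le_1: "T m i \<le> 1"
  using T_le[of m i] zero_le_power2[of "Z m i"] by linarith

lemma H_nonneg: "0 \<le> H m i"
  using H_ge[of m i] T_le_1[of m i] by linarith

lemma H_le_1: "H m i \<le> 1"
  using H_le'[of m i] Z_le_1[of m i] by linarith

lemma T_minus_run: "T (m + k) (i * 2 ^ k) = T m i ^ 2 ^ k"
proof (induction k)
  case (Suc k)
  have "T (m + Suc k) (i * 2 ^ Suc k) = T (Suc (m + k)) (2 * (i * 2 ^ k))"
    by (simp add: mult_ac)
  then show ?case by (simp only: T_minus Suc.IH) (simp add: power_mult [symmetric] mult.commute)
qed simp

lemma plus_index: "i * 2 ^ Suc k + (2 ^ Suc k - 1) = Suc (2 * (i * 2 ^ k + (2 ^ k - 1 :: nat)))"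
proof -
  obtain a where "(2::nat) ^ k = Suc a" by (metis not0_implies_Suc power_not_zero zero_neq_numeral)
  then show ?thesis by simp
qed

lemma Z_plus_run: "Z (m + k) (i * 2 ^ k + (2 ^ k - 1)) = Z m i ^ 2 ^ k"
proof (induction k)
  case (Suc k)
  have "Z (m + Suc k) (i * 2 ^ Suc k + (2 ^ Suc k - 1))
      = Z (Suc (m + k)) (Suc (2 * (i * 2 ^ k + (2 ^ k - 1))))"
    by (simp only: plus_index add_Suc_right)
  then show ?case by (simp only: Z_plus Suc.IH) (simp add: power_mult [symmetric] mult.commute)
qed simp

lemma Z_minus_run_le: "Z (m + k) (i * 2 ^ k) \<le> 2 ^ k * Z m i"
proof (induction k)
  case (Suc k)
  have "Z (m + Suc k) (i * 2 ^ Suc k) = Z (Suc (m + k)) (2 * (i * 2 ^ k))"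
    by (simp add: mult_ac)
  also have "\<dots> \<le> 2 * Z (m + k) (i * 2 ^ k)" by (rule Z_minus_le)
  finally show ?case using Suc by simp
qed simp

lemma T_plus_run_le: "T (m + k) (i * 2 ^ k + (2 ^ k - 1)) \<le> 2 ^ k * T m i"
proof (induction k)
  case (Suc k)
  have "T (m + Suc k) (i * 2 ^ Suc k + (2 ^ Suc k - 1))
      = T (Suc (m + k)) (Suc (2 * (i * 2 ^ k + (2 ^ k - 1))))"
    by (simp only: plus_index add_Suc_right)
  also have "\<dots> \<le> 2 * T (m + k) (i * 2 ^ k + (2 ^ k - 1))" by (rule T_plus_le)
  finally show ?case using Suc by simp
qed simp

definition core :: "real \<Rightarrow> nat \<Rightarrow> nat \<Rightarrow> bool" where
  "core d m i \<longleftrightarrow> d \<le> Z m i \<and> d \<le> T m i"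

lemma core_mono: "core d m i \<Longrightarrow> e \<le> d \<Longrightarrow> core e m i"
  by (auto simp: core_def)

lemma power2_ge_quarter: "1 / 2 \<le> x \<Longrightarrow> 1 / 4 \<le> (x::real)\<^sup>2"
  using power_mono[of "1/2" x 2] by (simp add: power2_eq_square)

lemma core_minus: "core d m i \<Longrightarrow> d \<le> 1 / 4 \<Longrightarrow> 1 / 2 \<le> T m i \<Longrightarrow> core d (Suc m) (2 * i)"
  using Z_minus_ge[of m i] power2_ge_quarter[of "T m i"] by (auto simp: core_def T_minus)

lemma core_plus: "core d m i \<Longrightarrow> d \<le> 1 / 4 \<Longrightarrow> 1 / 2 \<le> Z m i \<Longrightarrow> core d (Suc m) (Suc (2 * i))"
  using T_plus_ge[of m i] power2_ge_quarter[of "Z m i"] by (auto simp: core_def Z_plus)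

lemma core_descendant:
  assumes "core d m i" "d \<le> 1 / 4"
  shows "\<exists>j. j div 2 ^ k = i \<and> core d (m + k) j"
proof (induction k)
  case 0
  then show ?case using assms by simp
next
  case (Suc k)
  then obtain j where j: "j div 2 ^ k = i" "core d (m + k) j" by blast
  have *: "2 * j div 2 ^ Suc k = i" "Suc (2 * j) div 2 ^ Suc k = i"
    using j(1) by (simp_all add: div_mult2_eq)
  show ?case
  proof (cases "1 / 2 \<le> T (m + k) j")
    case True
    then show ?thesis using *(1) core_minus[OF j(2) assms(2)] by (intro exI[of _ "2 * j"]) simp
  next
    case False
    then have "1 / 2 \<le> Z (m + k) j" using T_Z_ge_1[of "m + k" j] by linarith
    then show ?thesis using *(2) core_plus[OF j(2) assms(2)] by (intro exI[of _ "Suc (2 * j)"]) simp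
  qed
qed

lemma square_run:
  fixes y :: real
  assumes "1 / 4 \<le> y" "y \<le> w" "w ^ 2 ^ J \<le> 1 / 2"
  shows "\<exists>k\<le>J. 1 / 4 \<le> y ^ 2 ^ k \<and> y ^ 2 ^ k \<le> 1 / 2"
proof -
  define k where "k = (LEAST k. y ^ 2 ^ k \<le> 1 / 2)"
  have J: "y ^ 2 ^ J \<le> 1 / 2"
    using power_mono[of y w "2 ^ J"] assms by linarith
  have k: "y ^ 2 ^ k \<le> 1 / 2" "k \<le> J"
    unfolding k_def using LeastI[of "\<lambda>k. y ^ 2 ^ k \<le> 1 / 2", OF J] Least_le[of "\<lambda>k. y ^ 2 ^ k \<le> 1 / 2", OF J]
    by simp_all
  have "1 / 4 \<le> y ^ 2 ^ k"
  proof (cases k)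
    case (Suc l)
    then have "\<not> y ^ 2 ^ l \<le> 1 / 2" 
      using not_less_Least[of l "\<lambda>k. y ^ 2 ^ k \<le> 1 / 2"] by (simp add: k_def)
    then have "1 / 4 \<le> (y ^ 2 ^ l)\<^sup>2" by (intro power2_ge_quarter) simp
    then show ?thesis unfolding Suc by (simp only: power_mult [symmetric] power_Suc2)
  qed (use assms in simp)
  with k show ?thesis by blast
qed

lemma core_return_minus:
  assumes "z \<le> Z m i" "0 \<le> z" "1 / 4 \<le> T m i" "(1 - z\<^sup>2 / 2) ^ 2 ^ J \<le> 1 / 2"
  shows "\<exists>j. j div 2 ^ J = i \<and> core (1 / 4) (m + J) j"
proof -
  have "z\<^sup>2 \<le> (Z m i)\<^sup>2" using assms by (intro power_mono)
  then have "T m i \<le> 1 - z\<^sup>2 / 2" using T_le[of m i] by linarith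
  from square_run[OF assms(3) this assms(4)] obtain k
    where k: "k \<le> J" "1 / 4 \<le> T m i ^ 2 ^ k" "T m i ^ 2 ^ k \<le> 1 / 2" by blast
  then have "core (1 / 4) (m + k) (i * 2 ^ k)"
    using T_Z_ge_1[of "m + k" "i * 2 ^ k"] by (simp add: core_def T_minus_run)
  from core_descendant[OF this, of "J - k"] k(1) obtain j
    where "j div 2 ^ (J - k) = i * 2 ^ k" "core (1 / 4) (m + J) j" by auto
  moreover have "j div 2 ^ J = j div 2 ^ (J - k) div 2 ^ k"
    using k(1) by (metis div_mult2_eq le_add_diff_inverse2 power_add)
  ultimately show ?thesis by auto
qed

lemma core_return_plus:
  assumes "z \<le> T m i" "0 \<le> z" "1 / 4 \<le> Z m i" "(1 - z\<^sup>2 / 2) ^ 2 ^ J \<le> 1 / 2"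
  shows "\<exists>j. j div 2 ^ J = i \<and> core (1 / 4) (m + J) j"
proof -
  have "z\<^sup>2 \<le> (T m i)\<^sup>2" using assms by (intro power_mono)
  then have "Z m i \<le> 1 - z\<^sup>2 / 2" using Z_le[of m i] by linarith
  from square_run[OF assms(3) this assms(4)] obtain k
    where k: "k \<le> J" "1 / 4 \<le> Z m i ^ 2 ^ k" "Z m i ^ 2 ^ k \<le> 1 / 2" by blast
  define i' where "i' = i * 2 ^ k + (2 ^ k - 1 :: nat)"
  have "core (1 / 4) (m + k) i'"
    using k T_Z_ge_1[of "m + k" i'] Z_plus_run[of m k i, folded i'_def] by (simp add: core_def)
  from core_descendant[OF this, of "J - k"] k(1) obtain j
    where "j div 2 ^ (J - k) = i'" "core (1 / 4) (m + J) j" by auto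
  moreover have "j div 2 ^ J = j div 2 ^ (J - k) div 2 ^ k"
    using k(1) by (metis div_mult2_eq le_add_diff_inverse2 power_add)
  moreover have "i' div 2 ^ k = i + (2 ^ k - 1) div 2 ^ k"
    unfolding i'_def by (rule div_mult_self3) simp
  ultimately show ?thesis by auto
qed

lemma core_children_return:
  assumes core: "core d m i" and d: "0 < d" "d \<le> 1 / 4"
    and J: "(1 - (d\<^sup>2)\<^sup>2 / 2) ^ 2 ^ J \<le> 1 / 2" and "b < 2"
  shows "\<exists>j. j div 2 ^ J = 2 * i + b \<and> core d (Suc m + J) j"
proof -
  have dd: "d\<^sup>2 \<le> d" "0 \<le> d\<^sup>2" using d by (auto simp: power2_eq_square)
  have minus: ?thesis if "core d (Suc m) (2 * i)" "b = 0"
    using core_descendant[OF that(1) d(2), of J] that(2) by auto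
  have plus: ?thesis if "core d (Suc m) (Suc (2 * i))" "b = 1"
    using core_descendant[OF that(1) d(2), of J] that(2) by auto
  have weaken: ?thesis if "\<exists>j. j div 2 ^ J = 2 * i + b \<and> core (1 / 4) (Suc m + J) j"
    using that core_mono d(2) by blast
  show ?thesis
  proof (cases "1 / 2 \<le> T m i")
    case True
    show ?thesis
    proof (cases "b = 0")
      case b: True
      show ?thesis by (rule minus[OF core_minus[OF core d(2) True] b])
    next
      case False
      then have b: "b = 1" using \<open>b < 2\<close> by simp
      have "d\<^sup>2 \<le> Z (Suc m) (Suc (2 * i))"
        using core d unfolding Z_plus core_def by (intro power_mono) auto
      moreover have "1 / 4 \<le> T (Suc m) (Suc (2 * i))" using T_plus_ge[of m i] True by linarith
      ultimately show ?thesis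
        using core_return_minus[OF _ dd(2) _ J, of "Suc m" "Suc (2 * i)"] b by (intro weaken) simp
    qed
  next
    case False
    then have Z: "1 / 2 \<le> Z m i" using T_Z_ge_1[of m i] by linarith
    show ?thesis
    proof (cases "b = 0")
      case b: True
      have "d\<^sup>2 \<le> T (Suc m) (2 * i)"
        using core d unfolding T_minus core_def by (intro power_mono) auto
      moreover have "1 / 4 \<le> Z (Suc m) (2 * i)" using Z_minus_ge[of m i] Z by linarith
      ultimately show ?thesis
        using core_return_plus[OF _ dd(2) _ J, of "Suc m" "2 * i"] b by (intro weaken) simp
    next
      case b: False
      then show ?thesis using plus[OF core_plus[OF core d(2) Z]] \<open>b < 2\<close> by auto
    qed
  qed
qed

definition core_set :: "real \<Rightarrow> nat \<Rightarrow> nat set" where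
  "core_set d m = {i \<in> {..<2 ^ m}. core d m i}"

lemma finite_core_set [simp]: "finite (core_set d m)"
  by (simp add: core_set_def)

lemma descendant_bound: "j div 2 ^ k < 2 ^ m \<Longrightarrow> j < (2::nat) ^ (m + k)"
  by (simp add: div_less_iff_less_mult power_add)

lemma core_card_step:
  assumes "d \<le> 1 / 4"
  shows "card (core_set d m) \<le> card (core_set d (m + k))"
proof -
  have "core_set d m \<subseteq> (\<lambda>j. j div 2 ^ k) ` core_set d (m + k)"
  proof
    fix i assume "i \<in> core_set d m"
    with core_descendant[of d m i k] assms obtain j
      where "j div 2 ^ k = i" "core d (m + k) j" "i < 2 ^ m" by (auto simp: core_set_def)
    then show "i \<in> (\<lambda>j. j div 2 ^ k) ` core_set d (m + k)"
      using descendant_bound[of j k m] by (auto simp: core_set_def image_iff)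
  qed
  then show ?thesis by (meson card_image_le card_mono finite_core_set finite_imageI le_trans)
qed

lemma core_card_double:
  assumes d: "0 < d" "d \<le> 1 / 4" and J: "(1 - (d\<^sup>2)\<^sup>2 / 2) ^ 2 ^ J \<le> 1 / 2"
  shows "2 * card (core_set d m) \<le> card (core_set d (m + Suc J))"
proof -
  have "(\<lambda>(i, b). 2 * i + b) ` (core_set d m \<times> {..<2}) \<subseteq> (\<lambda>j. j div 2 ^ J) ` core_set d (m + Suc J)"
  proof clarify
    fix i b :: nat assume i: "i \<in> core_set d m" and b: "b < 2"
    with core_children_return[OF _ d J, of m i b] obtain j
      where j: "j div 2 ^ J = 2 * i + b" "core d (m + Suc J) j" by (auto simp: core_set_def)
    have "j div 2 ^ J < 2 ^ Suc m" using i b j by (auto simp: core_set_def)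
    then have "j \<in> core_set d (m + Suc J)" using descendant_bound[of j J "Suc m"] j(2)
      by (auto simp: core_set_def)
    with j(1) show "2 * i + b \<in> (\<lambda>j. j div 2 ^ J) ` core_set d (m + Suc J)"
      by (metis image_eqI)
  qed
  moreover have "inj_on (\<lambda>(i, b). 2 * i + b) (core_set d m \<times> {..<2})"
    by (auto simp: inj_on_def) presburger+
  ultimately have "card (core_set d m \<times> {..<2::nat}) \<le> card (core_set d (m + Suc J))"
    by (meson card_image_le card_inj_on_le finite_core_set finite_imageI le_trans)
  then show ?thesis by (simp add: card_cartesian_product)
qed

lemma power_arbitrarily_small:
  fixes w e :: real
  assumes "0 \<le> w" "w < 1" "0 < e"
  shows "\<exists>J. w ^ 2 ^ J < e"
proof -
  obtain n where n: "w ^ n < e" using real_arch_pow_inv[OF assms(3,2)] by blast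
  have "w ^ 2 ^ n \<le> w ^ n" using assms by (intro power_decreasing) (auto intro: less_imp_le)
  with n show ?thesis by (meson le_less_trans)
qed

lemma core_growth: "\<exists>d>0. \<exists>r>0. d \<le> 1 / 4 \<and> (\<forall>m. 2 ^ (m div r) \<le> card (core_set d m))"
proof -
  define d where "d = min (1 / 4) (min (Z 0 0) (T 0 0))"
  have d: "0 < d" "d \<le> 1 / 4" "core d 0 0" using Z_root T_root by (auto simp: d_def core_def)
  have "(d\<^sup>2)\<^sup>2 \<le> 1" using d by (intro power_le_one) auto
  then obtain J where J: "(1 - (d\<^sup>2)\<^sup>2 / 2) ^ 2 ^ J < 1 / 2"
    using power_arbitrarily_small[of "1 - (d\<^sup>2)\<^sup>2 / 2" "1 / 2"] d(1) by auto
  have base: "1 \<le> card (core_set d 0)" using d by (simp add: core_set_def Suc_le_eq card_gt_0_iff)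
  have mult: "2 ^ q \<le> card (core_set d (q * Suc J))" for q
  proof (induction q)
    case (Suc q)
    have "2 ^ Suc q \<le> 2 * card (core_set d (q * Suc J))" using Suc by simp
    also have "\<dots> \<le> card (core_set d (q * Suc J + Suc J))"
      by (rule core_card_double[OF d(1,2)]) (use J in simp)
    finally show ?case by (simp only: mult_Suc add.commute)
  qed (use base in simp)
  have "2 ^ (m div Suc J) \<le> card (core_set d m)" for m
    using mult[of "m div Suc J"] core_card_step[OF d(2), of "m div Suc J * Suc J" "m mod Suc J"]
    by (metis div_mult_mod_eq le_trans)
  then show ?thesis using d by blast
qed


definition potential :: "real \<Rightarrow> nat \<Rightarrow> nat \<Rightarrow> real" where
  "potential a m i = (Z m i * T m i) powr a"

definition total_potential :: "real \<Rightarrow> nat \<Rightarrow> real" where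
  "total_potential a m = (\<Sum>i<2 ^ m. potential a m i)"

lemma potential_nonneg: "0 \<le> potential a m i"
  by (simp add: potential_def)

lemma potential_le_1: "0 < a \<Longrightarrow> potential a m i \<le> 1"
  using powr_mono2[of a "Z m i * T m i" 1] Z_nonneg T_nonneg Z_le_1 T_le_1
  by (simp add: potential_def mult_le_one)

lemma total_potential_nonneg: "0 \<le> total_potential a m"
  by (simp add: total_potential_def potential_nonneg sum_nonneg)

lemma sum_lessThan_double: "(\<Sum>i<2 * n. f i) = (\<Sum>i<n. f (2 * i) + f (Suc (2 * i)))"
  for f :: "nat \<Rightarrow> real"
  by (induction n) (simp_all add: algebra_simps)

lemma potential_minus:
  assumes "0 < a"
  shows "potential a (Suc m) (2 * i) \<le> 2 powr a * T m i powr a * potential a m i"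
proof -
  have "Z (Suc m) (2 * i) * T (Suc m) (2 * i) \<le> 2 * Z m i * (T m i)\<^sup>2"
    using Z_minus_le[of m i] by (simp add: T_minus mult_right_mono)
  then have "potential a (Suc m) (2 * i) \<le> (2 * Z m i * (T m i)\<^sup>2) powr a"
    unfolding potential_def using assms Z_nonneg T_nonneg by (intro powr_mono2) auto
  also have "\<dots> = 2 powr a * T m i powr a * potential a m i"
    using Z_nonneg[of m i] T_nonneg[of m i]
    by (simp add: potential_def powr_mult power2_eq_square algebra_simps)
  finally show ?thesis .
qed

lemma potential_plus:
  assumes "0 < a"
  shows "potential a (Suc m) (Suc (2 * i)) \<le> 2 powr a * Z m i powr a * potential a m i"
proof -
  have "Z (Suc m) (Suc (2 * i)) * T (Suc m) (Suc (2 * i)) \<le> (Z m i)\<^sup>2 * (2 * T m i)"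
    using T_plus_le[of m i] unfolding Z_plus by (intro mult_left_mono) auto
  then have "potential a (Suc m) (Suc (2 * i)) \<le> ((Z m i)\<^sup>2 * (2 * T m i)) powr a"
    unfolding potential_def using assms Z_nonneg T_nonneg by (intro powr_mono2) auto
  also have "\<dots> = 2 powr a * Z m i powr a * potential a m i"
    using Z_nonneg[of m i] T_nonneg[of m i]
    by (simp add: potential_def powr_mult power2_eq_square algebra_simps)
  finally show ?thesis .
qed

lemma total_potential_step:
  assumes a: "0 < a" "a \<le> 1" and x: "x = 2 powr a" and d: "0 < d" "d powr a = x - 1"
  shows "total_potential a (Suc m) \<le> x\<^sup>2 * total_potential a m + 4 * card (core_set d m)"
proof -
  have x1: "1 \<le> x" "x \<le> 2"
    using a powr_mono[of 0 a 2] powr_mono[of a 1 2] by (auto simp: x)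
  have step: "potential a (Suc m) (2 * i) + potential a (Suc m) (Suc (2 * i))
      \<le> x\<^sup>2 * potential a m i + (if core d m i then 4 else 0)" for i
  proof -
    define s where "s = T m i powr a + Z m i powr a"
    have T: "T m i powr a \<le> 1" using powr_mono2[of a "T m i" 1] a T_nonneg T_le_1 by simp
    have Z: "Z m i powr a \<le> 1" using powr_mono2[of a "Z m i" 1] a Z_nonneg Z_le_1 by simp
    have le: "potential a (Suc m) (2 * i) + potential a (Suc m) (Suc (2 * i)) \<le> x * s * potential a m i"
      using add_mono[OF potential_minus[OF a(1), of m i] potential_plus[OF a(1), of m i]]
      by (simp add: x s_def algebra_simps)
    show ?thesis
    proof (cases "core d m i")
      case True
      have "x * s \<le> 2 * 2" using x1 T Z by (intro mult_mono) (auto simp: s_def)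
      then have "x * s * potential a m i \<le> 4 * 1"
        using potential_le_1[OF a(1)] potential_nonneg by (intro mult_mono) auto
      moreover have "0 \<le> x\<^sup>2 * potential a m i" by (simp add: potential_nonneg)
      ultimately show ?thesis using le True by simp
    next
      case False
      then have "Z m i \<le> d \<or> T m i \<le> d" by (auto simp: core_def)
      then have "Z m i powr a \<le> x - 1 \<or> T m i powr a \<le> x - 1"
        using powr_mono2[of a "Z m i" d] powr_mono2[of a "T m i" d] a Z_nonneg T_nonneg d by auto
      then have "s \<le> x" using T Z unfolding s_def by linarith
      then have "x * s * potential a m i \<le> x * x * potential a m i"
        using x1 potential_nonneg by (intro mult_right_mono mult_left_mono) auto
      then show ?thesis using le False by (simp add: power2_eq_square)
    qed
  qed
  have "total_potential a (Suc m)
      = (\<Sum>i<2 ^ m. potential a (Suc m) (2 * i) + potential a (Suc m) (Suc (2 * i)))"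
    by (simp add: total_potential_def sum_lessThan_double)
  also have "\<dots> \<le> (\<Sum>i<2 ^ m. x\<^sup>2 * potential a m i + (if core d m i then 4 else 0))"
    by (intro sum_mono step)
  also have "\<dots> = x\<^sup>2 * total_potential a m + 4 * card (core_set d m)"
  proof -
    have "(\<Sum>i<2 ^ m. if core d m i then 4 else 0) = (\<Sum>i\<in>core_set d m. 4 :: real)"
      unfolding core_set_def by (subst sum.inter_filter) simp_all
    then show ?thesis by (simp add: total_potential_def sum.distrib sum_distrib_left)
  qed
  finally show ?thesis .
qed

lemma core_mass:
  obtains d \<eta> a \<gamma> c where "0 < d" "0 < \<eta>" "0 < a" "a \<le> 1 / 2" "1 < \<gamma>" "0 < c"
    and "\<And>m. c * \<gamma> ^ m \<le> total_potential a m"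
    and "\<And>m0. \<exists>m\<ge>m0. \<eta> * total_potential a m \<le> card (core_set d m)"
proof -
  obtain d0 r where d0: "0 < d0" "d0 \<le> 1 / 4" and r: "0 < r"
    and growth: "\<And>m. 2 ^ (m div r) \<le> card (core_set d0 m)"
    using core_growth by blast
  define a where "a = 1 / (3 * real r)"
  have a: "0 < a" "a \<le> 1 / 2" "a \<le> 1" using r by (auto simp: a_def field_simps)
  define x where "x = 2 powr a"
  have x1: "1 < x" using a powr_less_mono[of 0 a 2] by (simp add: x_def)
  have xr: "x ^ (3 * r) = 2"
    using r by (simp add: x_def powr_realpow [symmetric] powr_powr a_def)
  define d where "d = (x - 1) powr (1 / a)"
  have d: "0 < d" "d powr a = x - 1" using x1 a by (auto simp: d_def powr_powr)
  define \<eta> where "\<eta> = (x ^ 3 - x\<^sup>2) / 8"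
  have x23: "x\<^sup>2 < x ^ 3" using x1 by (simp add: power_strict_increasing)
  then have \<eta>: "0 < \<eta>" by (simp add: \<eta>_def)
  define y where "y = x\<^sup>2 + 4 * \<eta>"
  have y: "0 < y" "y < x ^ 3" using x23 x1 \<eta> by (auto simp: y_def \<eta>_def add_pos_pos field_simps)
  define c where "c = d0\<^sup>2 / 2"
  have c: "0 < c" using d0 by (simp add: c_def)
  have lower: "c * (x ^ 3) ^ m \<le> total_potential a m" for m
  proof -
    have "3 * m = 3 * r * (m div r) + 3 * (m mod r)"
      by (metis add_mult_distrib2 mult.assoc mult_div_mod_eq)
    then have "(x ^ 3) ^ m = (x ^ (3 * r)) ^ (m div r) * x ^ (3 * (m mod r))"
      by (simp only: power_mult [symmetric] power_add [symmetric])
    moreover have "x ^ (3 * (m mod r)) \<le> x ^ (3 * r)"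
      using x1 r by (intro power_increasing) (auto intro: less_imp_le)
    ultimately have 1: "(x ^ 3) ^ m \<le> 2 * 2 ^ (m div r)" by (simp add: xr)
    have pot: "d0\<^sup>2 \<le> potential a m i" if "i \<in> core_set d0 m" for i
    proof -
      have "d0 * d0 \<le> Z m i * T m i"
        using that d0 Z_nonneg by (intro mult_mono) (auto simp: core_set_def core_def)
      moreover have "Z m i * T m i \<le> (Z m i * T m i) powr a"
        using powr_mono'[of a 1 "Z m i * T m i"] a Z_nonneg T_nonneg Z_le_1 T_le_1
        by (simp add: mult_le_one)
      ultimately show ?thesis by (simp add: potential_def power2_eq_square)
    qed
    have "d0\<^sup>2 * 2 ^ (m div r) \<le> d0\<^sup>2 * card (core_set d0 m)"
      using of_nat_mono[OF growth[of m], where 'a=real] by (intro mult_left_mono) auto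
    also have "\<dots> = (\<Sum>i\<in>core_set d0 m. d0\<^sup>2)" by simp
    also have "\<dots> \<le> (\<Sum>i\<in>core_set d0 m. potential a m i)" by (intro sum_mono pot)
    also have "\<dots> \<le> total_potential a m"
      unfolding total_potential_def
      by (intro sum_mono2) (auto simp: core_set_def potential_nonneg)
    finally have "d0\<^sup>2 * 2 ^ (m div r) \<le> total_potential a m" .
    moreover have "c * (x ^ 3) ^ m \<le> c * (2 * 2 ^ (m div r))"
      using 1 c by (intro mult_left_mono) auto
    ultimately show ?thesis by (simp add: c_def)
  qed
  have "\<exists>m\<ge>m0. \<eta> * total_potential a m \<le> card (core_set d m)" for m0
  proof (rule ccontr)
    assume "\<not> ?thesis"
    then have small: "card (core_set d m) \<le> \<eta> * total_potential a m" if "m0 \<le> m" for m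
      using that by (meson linorder_not_le order_less_imp_le)
    have upper: "total_potential a (m0 + n) \<le> y ^ n * total_potential a m0" for n
    proof (induction n)
      case (Suc n)
      have "total_potential a (Suc (m0 + n)) \<le> y * total_potential a (m0 + n)"
        using total_potential_step[OF a(1,3) x_def d, of "m0 + n"] small[of "m0 + n"]
        by (simp add: y_def algebra_simps)
      also have "\<dots> \<le> y * (y ^ n * total_potential a m0)"
        using Suc y by (intro mult_left_mono) auto
      finally show ?case by simp
    qed simp
    have "1 < x ^ 3 / y" using y by simp
    then obtain n where n: "total_potential a m0 / (c * (x ^ 3) ^ m0) < (x ^ 3 / y) ^ n"
      using real_arch_pow by blast
    have pos: "0 < c * (x ^ 3) ^ m0" using c x1 by simp
    have "c * (x ^ 3) ^ m0 * (x ^ 3) ^ n \<le> y ^ n * total_potential a m0"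
      using lower[of "m0 + n"] upper[of n] by (simp add: power_add mult.assoc)
    then have "(x ^ 3 / y) ^ n \<le> total_potential a m0 / (c * (x ^ 3) ^ m0)"
      using pos y by (simp add: power_divide field_simps)
    with n show False by simp
  qed
  moreover have "1 < x ^ 3" using x1 by (simp add: one_less_power)
  ultimately show thesis by (intro that[where d = d and \<eta> = \<eta> and a = a and \<gamma> = "x ^ 3" and c = c] d(1) \<eta> a(1,2) c lower)
qed

lemma le_sqrt_mult_powr:
  fixes z e a :: real
  assumes "0 \<le> z" "z \<le> e" "e \<le> 1" "0 \<le> a" "a \<le> 1 / 2"
  shows "z \<le> sqrt e * z powr a"
proof -
  have "z = z powr (1 - a) * z powr a" using assms by (simp add: powr_add [symmetric])
  also have "\<dots> \<le> z powr (1 / 2) * z powr a"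
    using assms by (intro mult_right_mono powr_mono') auto
  also have "\<dots> \<le> sqrt e * z powr a"
    using assms by (intro mult_right_mono) (auto simp: powr_half_sqrt)
  finally show ?thesis .
qed

lemma sum_H: "(\<Sum>q<2 ^ k. H (m + k) (i * 2 ^ k + q)) = 2 ^ k * H m i"
proof (induction k)
  case (Suc k)
  have "(\<Sum>q<2 ^ Suc k. H (m + Suc k) (i * 2 ^ Suc k + q))
      = (\<Sum>q<2 ^ k. H (Suc (m + k)) (2 * (i * 2 ^ k + q)) + H (Suc (m + k)) (Suc (2 * (i * 2 ^ k + q))))"
    unfolding power_Suc sum_lessThan_double by (intro sum.cong) (simp_all add: algebra_simps)
  also have "\<dots> = 2 * (\<Sum>q<2 ^ k. H (m + k) (i * 2 ^ k + q))"
    by (simp only: H_split sum_distrib_left)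
  finally show ?case using Suc by simp
qed simp

lemma threshold:
  fixes F :: "nat \<Rightarrow> nat set"
  assumes F: "\<And>m. 1 \<le> m \<Longrightarrow> F m \<subseteq> {..<2 ^ m}"
    and card: "\<And>m. 1 \<le> m \<Longrightarrow> \<bar>card (F m) - 2 ^ m * H 0 0\<bar> \<le> 1"
    and worst: "\<And>m i j. 1 \<le> m \<Longrightarrow> i \<in> F m \<Longrightarrow> j < 2 ^ m \<Longrightarrow> j \<notin> F m \<Longrightarrow> T m i \<le> T m j"
  shows "\<exists>c>0. c \<le> 1 \<and> (\<forall>m0. \<exists>m\<ge>m0. \<forall>i<2 ^ m. (1 - c < T m i \<longrightarrow> i \<notin> F m) \<and> (T m i < c \<longrightarrow> i \<in> F m))"
proof -
  obtain d \<eta> a \<gamma> C where d: "0 < d" and \<eta>: "0 < \<eta>" and a: "0 < a" "a \<le> 1 / 2"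
    and \<gamma>: "1 < \<gamma>" and C: "0 < C" "\<And>m. C * \<gamma> ^ m \<le> total_potential a m"
    and mass: "\<And>m0. \<exists>m\<ge>m0. \<eta> * total_potential a m \<le> card (core_set d m)"
    by (rule core_mass) (rule that)
  define \<kappa> where "\<kappa> = d\<^sup>2 * \<eta> / 8"
  have \<kappa>: "0 < \<kappa>" using d \<eta> by (simp add: \<kappa>_def)
  define e where "e = min (1 / 4) (min (d / 2) ((\<kappa> / 6)\<^sup>2))"
  have e: "0 < e" "e \<le> 1 / 4" "e < d" "e \<le> (\<kappa> / 6)\<^sup>2" using d \<kappa> by (auto simp: e_def)
  have sqrt_e: "6 * sqrt e \<le> \<kappa>" using real_sqrt_le_mono[OF e(4)] \<kappa> by simp
  define c where "c = e\<^sup>2 / 2"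
  have "e\<^sup>2 \<le> e * 1" using e unfolding power2_eq_square by (intro mult_left_mono) auto
  moreover have "0 < c" using e by (simp add: c_def)
  ultimately have c: "0 < c" "c \<le> e" "c \<le> 1 / 2" using e(1,2) unfolding c_def by linarith+
  have "\<exists>m\<ge>m0. \<forall>i<2 ^ m. (1 - c < T m i \<longrightarrow> i \<notin> F m) \<and> (T m i < c \<longrightarrow> i \<in> F m)" for m0
  proof -
    obtain n where n: "1 / (\<kappa> * C) < \<gamma> ^ n" using real_arch_pow[OF \<gamma>] by blast
    obtain m where m: "max (max m0 1) n \<le> m" and core: "\<eta> * total_potential a m \<le> card (core_set d m)"
      using mass by blast
    define A where "A = total_potential a m"
    have "\<gamma> ^ n \<le> \<gamma> ^ m" using m \<gamma> by (intro power_increasing) auto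
    then have "1 / (\<kappa> * C) < \<gamma> ^ m" using n by linarith
    then have "1 < \<kappa> * (C * \<gamma> ^ m)" using \<kappa> C(1) by (simp add: field_simps)
    also have "\<dots> \<le> \<kappa> * A" unfolding A_def using C(2) \<kappa> by (intro mult_left_mono) auto
    finally have A1: "1 < \<kappa> * A" .
    have A0: "0 \<le> A" by (simp add: A_def total_potential_nonneg)
    have m1: "1 \<le> m" using m by simp
    define G where "G = {..<2 ^ m} - F m"
    have fin: "finite (F m)" "finite G" using F[OF m1] finite_subset by (auto simp: G_def)
    have "(\<Sum>i\<in>F m. H m i) + (\<Sum>i\<in>G. H m i) = 2 ^ m * H 0 0"
      using sum.subset_diff[OF F[OF m1], of "H m"] sum_H[of 0 m 0] by (simp add: G_def)
    then have balance: "\<bar>(\<Sum>i\<in>F m. 1 - H m i) - (\<Sum>i\<in>G. H m i)\<bar> \<le> 1"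
      using card[OF m1] by (simp add: sum_subtractf)
    have core_card: "8 * \<kappa> * A \<le> d\<^sup>2 * card (core_set d m)"
    proof -
      have "8 * \<kappa> * A = d\<^sup>2 * (\<eta> * A)" by (simp add: \<kappa>_def)
      also have "\<dots> \<le> d\<^sup>2 * card (core_set d m)" using core unfolding A_def by (intro mult_left_mono) auto
      finally show ?thesis .
    qed
    have d2: "d\<^sup>2 \<le> (T m i)\<^sup>2" "d\<^sup>2 \<le> (Z m i)\<^sup>2" if "i \<in> core_set d m" for i
      using that d by (auto simp: core_set_def core_def intro!: power_mono)
    have part: "(\<Sum>i\<in>S. potential a m i) \<le> A" if "S \<subseteq> {..<2 ^ m}" for S
      unfolding A_def total_potential_def using that by (intro sum_mono2) (auto simp: potential_nonneg)
    have "i \<notin> F m" if i: "i < 2 ^ m" "1 - c < T m i" for i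
    proof
      assume "i \<in> F m"
      then have T: "1 - c < T m j" if "j \<in> G" for j
        using worst[OF m1 \<open>i \<in> F m\<close>, of j] that i by (auto simp: G_def)
      have Z: "Z m j < e" if "j \<in> G" for j
      proof -
        have "(Z m j)\<^sup>2 < e\<^sup>2" using T[OF that] T_le[of m j] by (simp add: c_def)
        then show ?thesis using e(1) by (simp add: power2_less_imp_less)
      qed
      have "core_set d m \<subseteq> F m"
      proof
        fix j assume "j \<in> core_set d m"
        then show "j \<in> F m" using Z[of j] e(3) by (cases "j \<in> F m") (auto simp: core_set_def core_def G_def)
      qed
      then have "(\<Sum>i\<in>core_set d m. d\<^sup>2 / 4) \<le> (\<Sum>i\<in>F m. 1 - H m i)"
      proof (intro order_trans[OF sum_mono sum_mono2] fin(1))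
        show "d\<^sup>2 / 4 \<le> 1 - H m i" if "i \<in> core_set d m" for i
          using H_le'[of m i] Z_le[of m i] d2(1)[OF that] by linarith
      qed (use H_le_1 in auto)
      moreover have "(\<Sum>i\<in>G. H m i) \<le> (\<Sum>i\<in>G. 6 * sqrt e * potential a m i)"
      proof (intro sum_mono)
        fix j assume j: "j \<in> G"
        have "1 / 2 \<le> T m j" using T[OF j] c by linarith
        also have "T m j \<le> T m j powr a"
          using powr_mono'[of a 1 "T m j"] a T_nonneg T_le_1 by simp
        finally have "1 \<le> 2 * T m j powr a" by simp
        moreover have "3 * Z m j \<le> 3 * (sqrt e * Z m j powr a)"
          using le_sqrt_mult_powr[of "Z m j" e a] Z[OF j] Z_nonneg a e by simp
        ultimately have "3 * Z m j * 1 \<le> 3 * (sqrt e * Z m j powr a) * (2 * T m j powr a)"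
          using Z_nonneg e by (intro mult_mono) auto
        then show "H m j \<le> 6 * sqrt e * potential a m j"
          using H_le[of m j] Z_nonneg T_nonneg by (simp add: potential_def powr_mult algebra_simps)
      qed
      moreover have "(\<Sum>i\<in>G. 6 * sqrt e * potential a m i) \<le> \<kappa> * A"
        unfolding sum_distrib_left [symmetric] using sqrt_e \<kappa> part
        by (intro mult_mono) (auto simp: G_def intro!: sum_nonneg potential_nonneg)
      moreover have "(\<Sum>i\<in>core_set d m. d\<^sup>2 / 4) = d\<^sup>2 * card (core_set d m) / 4" by simp
      ultimately show False using balance core_card A1 by linarith
    qed
    moreover have "i \<in> F m" if i: "i < 2 ^ m" "T m i < c" for i
    proof (rule ccontr)
      assume "i \<notin> F m"
      then have T: "T m j < c" if "j \<in> F m" for j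
        using worst[OF m1 that i(1)] i(2) by auto
      have "core_set d m \<subseteq> G"
      proof
        fix j assume "j \<in> core_set d m"
        then show "j \<in> G" using T[of j] e(3) c(2) by (cases "j \<in> F m") (auto simp: core_set_def core_def G_def)
      qed
      then have "(\<Sum>i\<in>core_set d m. d\<^sup>2 / 4) \<le> (\<Sum>i\<in>G. H m i)"
      proof (intro order_trans[OF sum_mono sum_mono2] fin(2))
        show "d\<^sup>2 / 4 \<le> H m i" if "i \<in> core_set d m" for i
          using H_ge[of m i] T_le[of m i] d2(2)[OF that] zero_le_power2[of d] by linarith
      qed (use H_nonneg in auto)
      moreover have "(\<Sum>i\<in>F m. 1 - H m i) \<le> (\<Sum>i\<in>F m. 6 * sqrt e * potential a m i)"
      proof (intro sum_mono)
        fix j assume j: "j \<in> F m"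
        have "1 / 2 \<le> Z m j" using T[OF j] T_Z_ge_1[of m j] c by linarith
        also have "Z m j \<le> Z m j powr a"
          using powr_mono'[of a 1 "Z m j"] a Z_nonneg Z_le_1 by simp
        finally have "1 \<le> 6 * Z m j powr a" by simp
        moreover have "T m j \<le> sqrt e * T m j powr a"
          using le_sqrt_mult_powr[of "T m j" e a] T[OF j] T_nonneg a e c by simp
        ultimately have "T m j * 1 \<le> sqrt e * T m j powr a * (6 * Z m j powr a)"
          using T_nonneg e by (intro mult_mono) auto
        then show "1 - H m j \<le> 6 * sqrt e * potential a m j"
          using H_ge[of m j] Z_nonneg T_nonneg by (simp add: potential_def powr_mult algebra_simps)
      qed
      moreover have "(\<Sum>i\<in>F m. 6 * sqrt e * potential a m i) \<le> \<kappa> * A"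
        unfolding sum_distrib_left [symmetric] using sqrt_e \<kappa> part F[OF m1]
        by (intro mult_mono) (auto intro!: sum_nonneg potential_nonneg)
      moreover have "(\<Sum>i\<in>core_set d m. d\<^sup>2 / 4) = d\<^sup>2 * card (core_set d m) / 4" by simp
      ultimately show False using balance core_card A1 by linarith
    qed
    ultimately have "\<forall>i<2 ^ m. (1 - c < T m i \<longrightarrow> i \<notin> F m) \<and> (T m i < c \<longrightarrow> i \<in> F m)" by blast
    moreover have "m0 \<le> m" using m by simp
    ultimately show ?thesis by blast
  qed
  moreover have "c \<le> 1" using c(3) by simp
  ultimately show ?thesis using c(1) by blast
qed

lemma digits_bound:
  fixes x y z u :: nat
  assumes "x < u" "z < y"
  shows "x * y + z < u * y"
proof -
  have "x * y + z < Suc x * y" using assms(2) by simp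
  also have "\<dots> \<le> u * y" using assms(1) by (intro mult_right_mono) auto
  finally show ?thesis .
qed

lemma few_large:
  fixes f :: "nat \<Rightarrow> real"
  assumes "\<And>q. q < n \<Longrightarrow> 0 \<le> f q" "(\<Sum>q<n. f q) \<le> s * t * real n" "0 < t"
  shows "card {q \<in> {..<n}. t \<le> f q} \<le> s * real n"
proof -
  have "t * card {q \<in> {..<n}. t \<le> f q} = (\<Sum>q\<in>{q \<in> {..<n}. t \<le> f q}. t)" by simp
  also have "\<dots> \<le> (\<Sum>q\<in>{q \<in> {..<n}. t \<le> f q}. f q)" by (intro sum_mono) auto
  also have "\<dots> \<le> (\<Sum>q<n. f q)" using assms(1) by (intro sum_mono2) auto
  finally have "t * card {q \<in> {..<n}. t \<le> f q} \<le> t * (s * real n)" using assms(2) by (simp add: mult_ac)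
  then show ?thesis using assms(3) by simp
qed

lemma mult_power_small:
  fixes w e :: real
  assumes "0 \<le> w" "w < 1" "0 < e"
  shows "\<exists>k. 2 ^ k * w ^ 2 ^ k < e"
proof -
  have "(\<lambda>n. real n * w ^ n) \<longlonglongrightarrow> 0"
    using assms by (intro powser_times_n_limit_0) auto
  then have "eventually (\<lambda>n. real n * w ^ n < e) sequentially"
    using assms(3) by (rule order_tendstoD)
  then obtain N where N: "\<And>n. N \<le> n \<Longrightarrow> real n * w ^ n < e"
    by (auto simp: eventually_sequentially)
  have "N \<le> 2 ^ N" by (simp add: less_imp_le)
  from N[OF this] show ?thesis by auto
qed

lemma block_separation:
  assumes c: "0 < c" "c \<le> 1"
  obtains k where "\<And>m F L. (\<And>i. i < 2 ^ m \<Longrightarrow> (1 - c < T m i \<longrightarrow> i \<notin> F) \<and> (T m i < c \<longrightarrow> i \<in> F)) \<Longrightarrow>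
    L + 2 * k \<le> m \<Longrightarrow> \<exists>p<2 ^ (m - 2 * k - L). \<exists>q<2 ^ L.
       ((p * 2 ^ k + (2 ^ k - 1)) * 2 ^ k) * 2 ^ L + q \<notin> F \<and>
       ((p * 2 ^ k) * 2 ^ k + (2 ^ k - 1)) * 2 ^ L + q \<in> F"
proof -
  obtain d r where d: "0 < d" "d \<le> 1 / 4" and growth: "\<And>m. 2 ^ (m div r) \<le> card (core_set d m)"
    using core_growth by blast
  define w where "w = 1 - d\<^sup>2 / 2"
  have "d\<^sup>2 \<le> 1" using d by (intro power_le_one) auto
  then have w: "0 \<le> w" "w < 1" using d by (auto simp: w_def)
  obtain k where k: "2 ^ k * w ^ 2 ^ k < c\<^sup>2 / 16" using mult_power_small[OF w, of "c\<^sup>2 / 16"] c by auto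
  have "\<exists>p<2 ^ (m - 2 * k - L). \<exists>q<2 ^ L.
       ((p * 2 ^ k + (2 ^ k - 1)) * 2 ^ k) * 2 ^ L + q \<notin> F \<and>
       ((p * 2 ^ k) * 2 ^ k + (2 ^ k - 1)) * 2 ^ L + q \<in> F"
    if thr: "\<And>i. i < 2 ^ m \<Longrightarrow> (1 - c < T m i \<longrightarrow> i \<notin> F) \<and> (T m i < c \<longrightarrow> i \<in> F)"
      and L: "L + 2 * k \<le> m" for m F L
  proof -
    define n where "n = m - 2 * k - L"
    have m: "m = n + k + k + L" using L by (simp add: n_def)
    have "core_set d n \<noteq> {}" using growth[of n] by (intro notI) simp
    then obtain p where p: "p < 2 ^ n" "core d n p" by (auto simp: core_set_def)
    have d2: "d\<^sup>2 \<le> (T n p)\<^sup>2" "d\<^sup>2 \<le> (Z n p)\<^sup>2" using p d by (auto simp: core_def intro!: power_mono)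
    define good where "good = (p * 2 ^ k + (2 ^ k - 1)) * 2 ^ k"
    define bad where "bad = (p * 2 ^ k) * 2 ^ k + (2 ^ k - 1 :: nat)"
    have kk: "(2::nat) ^ k - 1 < 2 ^ k" by simp
    have lt: "good < 2 ^ (n + k + k)" "bad < 2 ^ (n + k + k)"
      using digits_bound[OF p(1) kk] digits_bound[OF digits_bound[OF p(1), of 0 "2 ^ k"] kk]
      by (auto simp: good_def bad_def power_add)
    have "Z (n + k + k) good \<le> 2 ^ k * Z n p ^ 2 ^ k"
      using Z_minus_run_le[of "n + k" k "p * 2 ^ k + (2 ^ k - 1)"] by (simp only: good_def Z_plus_run)
    also have "\<dots> \<le> 2 ^ k * w ^ 2 ^ k"
      using Z_le[of n p] d2 Z_nonneg by (intro mult_left_mono power_mono) (auto simp: w_def)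
    finally have Zg: "Z (n + k + k) good \<le> c\<^sup>2 / 16" using k by simp
    have "T (n + k + k) bad \<le> 2 ^ k * T n p ^ 2 ^ k"
      using T_plus_run_le[of "n + k" k "p * 2 ^ k"] by (simp only: bad_def T_minus_run)
    also have "\<dots> \<le> 2 ^ k * w ^ 2 ^ k"
      using T_le[of n p] d2 T_nonneg by (intro mult_left_mono power_mono) (auto simp: w_def)
    finally have Tb: "T (n + k + k) bad \<le> c\<^sup>2 / 16" using k by simp
    define B1 where "B1 = {q \<in> {..<2 ^ L}. c \<le> H m (good * 2 ^ L + q)}"
    define B2 where "B2 = {q \<in> {..<2 ^ L}. c\<^sup>2 / 4 \<le> 1 - H m (bad * 2 ^ L + q)}"
    have "card B1 \<le> 3 / 16 * real (2 ^ L)"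
      unfolding B1_def
    proof (rule few_large)
      have "c\<^sup>2 \<le> c" using c by (simp add: power2_eq_square mult_le_one)
      then have "H (n + k + k) good \<le> 3 / 16 * c" using H_le[of "n + k + k" good] Zg by linarith
      then show "(\<Sum>q<2 ^ L. H m (good * 2 ^ L + q)) \<le> 3 / 16 * c * real (2 ^ L)"
        using sum_H[of "n + k + k" L good] by (simp add: m mult.commute)
    qed (use c H_nonneg H_le_1 in auto)
    moreover have "card B2 \<le> 1 / 4 * real (2 ^ L)"
      unfolding B2_def
    proof (rule few_large)
      have "1 - H (n + k + k) bad \<le> 1 / 4 * (c\<^sup>2 / 4)" using H_ge[of "n + k + k" bad] Tb by linarith
      then have "2 ^ L * (1 - H (n + k + k) bad) \<le> 2 ^ L * (1 / 4 * (c\<^sup>2 / 4))"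
        by (intro mult_left_mono) auto
      then show "(\<Sum>q<2 ^ L. 1 - H m (bad * 2 ^ L + q)) \<le> 1 / 4 * (c\<^sup>2 / 4) * real (2 ^ L)"
        using sum_H[of "n + k + k" L bad] by (simp add: m sum_subtractf algebra_simps)
    qed (use c H_nonneg H_le_1 in auto)
    moreover have "real (card (B1 \<union> B2)) \<le> real (card B1) + real (card B2)"
      using card_Un_le[of B1 B2] by linarith
    moreover have "0 < real (2 ^ L)" by simp
    ultimately have "real (card (B1 \<union> B2)) < real (2 ^ L)" by linarith
    moreover have "finite (B1 \<union> B2)" by (simp add: B1_def B2_def)
    ultimately have "\<not> {..<2 ^ L} \<subseteq> B1 \<union> B2"
      using card_mono[of "B1 \<union> B2" "{..<2 ^ L}"] by fastforce
    then obtain q where q: "q < 2 ^ L" "q \<notin> B1" "q \<notin> B2" by blast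
    have lt_m: "good * 2 ^ L + q < 2 ^ m" "bad * 2 ^ L + q < 2 ^ m"
      using digits_bound[OF lt(1) q(1)] digits_bound[OF lt(2) q(1)] by (auto simp: m power_add)
    have "1 - c < T m (good * 2 ^ L + q)"
      using q H_ge[of m "good * 2 ^ L + q"] by (simp add: B1_def)
    moreover have "T m (bad * 2 ^ L + q) < c"
    proof -
      have "(T m (bad * 2 ^ L + q))\<^sup>2 < c\<^sup>2"
        using q H_le'[of m "bad * 2 ^ L + q"] Z_le[of m "bad * 2 ^ L + q"] by (simp add: B2_def)
      then show ?thesis using c by (simp add: power2_less_imp_less)
    qed
    ultimately have "good * 2 ^ L + q \<notin> F \<and> bad * 2 ^ L + q \<in> F"
      using thr[OF lt_m(1)] thr[OF lt_m(2)] by simp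
    then show ?thesis
      using p(1) q(1) unfolding good_def bad_def n_def by (intro exI[of _ p] exI[of _ q] conjI) auto
  qed
  then show thesis by (rule that)
qed

end

section \<open>Pointwise inequalities\<close>

definition ent_loss :: "real \<Rightarrow> real \<Rightarrow> real" where
  "ent_loss a b = (a + b) * log 2 (a + b) - a * log 2 a - b * log 2 b"

lemma ent_loss_commute: "ent_loss a b = ent_loss b a"
  by (simp add: ent_loss_def add.commute)

lemma ent_loss_0 [simp]: "ent_loss 0 b = 0" "ent_loss a 0 = 0"
  by (simp_all add: ent_loss_def)

lemma ent_loss_pos:
  assumes "0 < a" "0 < b"
  shows "ent_loss a b * ln 2 = a * ln (1 + b / a) + b * ln (1 + a / b)"
proof -
  have "1 + b / a = (a + b) / a" "1 + a / b = (a + b) / b" using assms by (simp_all add: field_simps)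
  moreover have "ent_loss a b * ln 2 = (a + b) * ln (a + b) - a * ln a - b * ln b"
    by (simp add: ent_loss_def log_def left_diff_distrib)
  ultimately show ?thesis using assms by (simp add: ln_div algebra_simps)
qed

lemma ln_1_plus_ge:
  fixes x :: real
  assumes "0 \<le> x" "x \<le> 1"
  shows "x * ln 2 \<le> ln (1 + x)"
proof -
  have "exp ((1 - x) *\<^sub>R 0 + x *\<^sub>R ln 2) \<le> (1 - x) * exp 0 + x * exp (ln 2 :: real)"
    using assms by (intro convex_onD[OF exp_convex]) auto
  then have "exp (x * ln 2) \<le> 1 + x" by simp
  then show ?thesis using assms by (subst ln_ge_iff) auto
qed

lemma ln_1_plus_le_sqrt:
  fixes x :: real
  assumes "0 \<le> x"
  shows "ln (1 + x) \<le> 2 * sqrt x"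
proof -
  have "1 + x \<le> (1 + sqrt x)\<^sup>2" using assms by (simp add: power2_sum)
  then have "ln (1 + x) \<le> ln ((1 + sqrt x)\<^sup>2)" using assms by (subst ln_le_cancel_iff) (auto simp: add_pos_nonneg)
  also have "\<dots> = 2 * ln (1 + sqrt x)" using assms by (simp add: ln_realpow add_pos_nonneg)
  also have "\<dots> \<le> 2 * sqrt x" using ln_add_one_self_le_self[of "sqrt x"] assms by simp
  finally show ?thesis .
qed

lemma ent_loss_ge:
  assumes "0 \<le> a" "0 \<le> b"
  shows "a + b - \<bar>a - b\<bar> \<le> ent_loss a b"
proof -
  have *: "2 * a \<le> ent_loss a b" if "0 < a" "a \<le> b" for a b
  proof -
    have "ln 2 \<le> ln (1 + b / a)" using that by (subst ln_le_cancel_iff) (auto simp: add_pos_nonneg)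
    then have "a * ln 2 \<le> a * ln (1 + b / a)" using that by (intro mult_left_mono) auto
    moreover have "b * (a / b * ln 2) \<le> b * ln (1 + a / b)"
      using that by (intro mult_left_mono ln_1_plus_ge) auto
    then have "a * ln 2 \<le> b * ln (1 + a / b)" using that by simp
    ultimately have "a * ln 2 + a * ln 2 \<le> a * ln (1 + b / a) + b * ln (1 + a / b)" by (rule add_mono)
    also have "\<dots> = ent_loss a b * ln 2" using that by (intro ent_loss_pos [symmetric]) auto
    finally have "a * ln 2 + a * ln 2 \<le> ent_loss a b * ln 2" .
    then have "(2 * a) * ln 2 \<le> ent_loss a b * ln 2" by simp
    then show ?thesis by simp
  qed
  consider "a = 0 \<or> b = 0" | "0 < a" "a \<le> b" | "0 < b" "b \<le> a" using assms by linarith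
  then show ?thesis
  proof cases
    case 1 then show ?thesis using assms by auto
  next
    case 2 then show ?thesis using *[of a b] by simp
  next
    case 3 then show ?thesis using *[of b a] by (simp add: ent_loss_commute)
  qed
qed

lemma ent_loss_nonneg: "0 \<le> a \<Longrightarrow> 0 \<le> b \<Longrightarrow> 0 \<le> ent_loss a b"
  using ent_loss_ge[of a b] by (simp add: abs_if split: if_splits)

lemma ent_loss_le:
  assumes "0 \<le> a" "0 \<le> b"
  shows "ent_loss a b \<le> 6 * sqrt (a * b)"
proof (cases "a = 0 \<or> b = 0")
  case False
  then have ab: "0 < a" "0 < b" using assms by auto
  have *: "a * sqrt (b / a) = sqrt (a * b)" if "0 < a" "0 < b" for a b :: real
    using that by (simp add: real_sqrt_divide real_sqrt_mult field_simps)
  have "a * ln (1 + b / a) \<le> a * (2 * sqrt (b / a))"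
    using ab by (intro mult_left_mono ln_1_plus_le_sqrt) auto
  moreover have "b * ln (1 + a / b) \<le> b * (2 * sqrt (a / b))"
    using ab by (intro mult_left_mono ln_1_plus_le_sqrt) auto
  ultimately have "ent_loss a b * ln 2 \<le> 4 * sqrt (a * b)"
    using ent_loss_pos[OF ab] *[OF ab] *[OF ab(2,1)] by (simp add: mult.commute)
  also have "\<dots> \<le> (6 * sqrt (a * b)) * ln 2"
    using mult_left_mono[OF ln2_ge_two_thirds, of "6 * sqrt (a * b)"] ab by simp
  finally show ?thesis by simp
qed auto

lemma ent_loss_le_mean:
  assumes "0 \<le> a" "0 \<le> b"
  shows "ent_loss a b \<le> (a + b) / 2 + sqrt (a * b)"
proof (cases "a = 0 \<or> b = 0")
  case False
  then have ab: "0 < a" "0 < b" using assms by auto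
  define p q r where "p = sqrt a" and "q = sqrt b" and "r = sqrt ((a + b) / 2)"
  have pqr: "a = p\<^sup>2" "b = q\<^sup>2" "p\<^sup>2 + q\<^sup>2 = 2 * r\<^sup>2" "0 < p" "0 < q" "0 < r"
    using ab by (auto simp: p_def q_def r_def)
  have half: "u\<^sup>2 * ln (1 + v\<^sup>2 / u\<^sup>2) \<le> u\<^sup>2 * ln 2 + 2 * (u * r - u\<^sup>2)"
    if "0 < u" "u\<^sup>2 + v\<^sup>2 = 2 * r\<^sup>2" for u v
  proof -
    have "1 + v\<^sup>2 / u\<^sup>2 = 2 * (r / u)\<^sup>2" using that by (simp add: field_simps power_divide)
    then have "ln (1 + v\<^sup>2 / u\<^sup>2) = ln 2 + 2 * ln (r / u)"
      using that pqr by (simp add: ln_mult ln_realpow)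
    also have "\<dots> \<le> ln 2 + 2 * (r / u - 1)" using that pqr ln_le_minus_one[of "r / u"] by simp
    finally have "u\<^sup>2 * ln (1 + v\<^sup>2 / u\<^sup>2) \<le> u\<^sup>2 * (ln 2 + 2 * (r / u - 1))"
      by (intro mult_left_mono) auto
    also have "\<dots> = u\<^sup>2 * ln 2 + 2 * (u * r - u\<^sup>2)"
      using that by (simp add: field_simps power2_eq_square)
    finally show ?thesis .
  qed
  have "ent_loss a b * ln 2 \<le> (a + b) * ln 2 + 2 * (p * r + q * r - p\<^sup>2 - q\<^sup>2)"
  proof -
    have "p\<^sup>2 * ln (1 + q\<^sup>2 / p\<^sup>2) + q\<^sup>2 * ln (1 + p\<^sup>2 / q\<^sup>2)
        \<le> (p\<^sup>2 * ln 2 + 2 * (p * r - p\<^sup>2)) + (q\<^sup>2 * ln 2 + 2 * (q * r - q\<^sup>2))"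
      using pqr(3-5) by (intro add_mono half) simp_all
    also have "\<dots> = (a + b) * ln 2 + 2 * (p * r + q * r - p\<^sup>2 - q\<^sup>2)"
      unfolding pqr(1,2) by (simp add: algebra_simps)
    finally show ?thesis unfolding ent_loss_pos[OF ab] by (simp only: pqr(1,2))
  qed
  also have "2 * (p * r + q * r - p\<^sup>2 - q\<^sup>2) \<le> p * q - r\<^sup>2"
  proof -
    have "0 \<le> 2 * (r - (p + q) / 2)\<^sup>2" by simp
    also have "\<dots> = p * q - r\<^sup>2 - 2 * (p * r + q * r - p\<^sup>2 - q\<^sup>2)"
      using pqr(3) by (simp add: power2_eq_square field_simps)
    finally show ?thesis by simp
  qed
  also have "p * q - r\<^sup>2 \<le> (p * q - r\<^sup>2) * ln 2"
  proof -
    have "0 \<le> (p - q)\<^sup>2" by simp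
    then have "p * q - r\<^sup>2 \<le> 0" using pqr(3) by (simp add: power2_diff)
    then show ?thesis using mult_left_mono_neg[of "ln 2" 1 "p * q - r\<^sup>2"] ln_2_less_1 by simp
  qed
  also have "(a + b) * ln 2 + (p * q - r\<^sup>2) * ln 2 = ((a + b) / 2 + sqrt (a * b)) * ln 2"
    using pqr(1-3) by (simp add: p_def q_def real_sqrt_mult algebra_simps)
  finally show ?thesis by simp
qed (use assms in auto)

lemma sqrt_mult_le:
  fixes a b t :: real
  assumes "0 \<le> a" "0 \<le> b"
  shows "sqrt (a * b) \<le> (a + b) / 2 - (2 * t * \<bar>a - b\<bar> - t\<^sup>2 * (a + b)) / 4"
proof -
  define p q where "p = sqrt a" and "q = sqrt b"
  have pq: "a = p\<^sup>2" "b = q\<^sup>2" "0 \<le> p" "0 \<le> q" using assms by (auto simp: p_def q_def)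
  define x where "x = \<bar>p - q\<bar>"
  have ab: "\<bar>a - b\<bar> = x * (p + q)"
    using pq(3,4) by (simp add: x_def pq(1,2) power2_eq_square square_diff_square_factored abs_mult)
  have x2: "x\<^sup>2 = p\<^sup>2 + q\<^sup>2 - 2 * (p * q)" by (simp add: x_def power2_diff)
  have s2: "(p + q)\<^sup>2 = p\<^sup>2 + q\<^sup>2 + 2 * (p * q)" by (simp add: power2_sum)
  have "0 \<le> 4 * (x - t * (p + q) / 2)\<^sup>2 + t\<^sup>2 * x\<^sup>2" by simp
  also have "\<dots> = 4 * x\<^sup>2 - 4 * t * (x * (p + q)) + t\<^sup>2 * ((p + q)\<^sup>2 + x\<^sup>2)"
    by (simp add: power2_eq_square field_simps)
  also have "\<dots> = 4 * (p\<^sup>2 + q\<^sup>2) - 8 * (p * q) - 4 * t * (x * (p + q)) + 2 * (t\<^sup>2 * (p\<^sup>2 + q\<^sup>2))"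
    unfolding x2 s2 by (simp add: algebra_simps)
  finally have "8 * (p * q) \<le> 4 * (a + b) - 4 * t * \<bar>a - b\<bar> + 2 * (t\<^sup>2 * (a + b))"
    unfolding ab by (simp add: pq(1,2))
  moreover have "sqrt (a * b) = p * q" by (simp add: p_def q_def real_sqrt_mult)
  ultimately show ?thesis by (simp add: field_simps)
qed

lemma sqrt_mult_le':
  fixes a b t :: real
  assumes "0 \<le> a" "0 \<le> b" "0 \<le> t"
  shows "2 * t * sqrt (a * b) \<le> (a + b - \<bar>a - b\<bar>) / 2 + t\<^sup>2 * (a + b)"
proof -
  have *: "2 * t * sqrt (a * b) \<le> a + t\<^sup>2 * (a + b)" if "0 \<le> a" "0 \<le> b" for a b :: real
  proof -
    have "0 \<le> (sqrt a - t * sqrt b)\<^sup>2" by simp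
    also have "\<dots> = a + t\<^sup>2 * b - 2 * t * sqrt (a * b)"
      using that by (simp add: power2_diff power_mult_distrib real_sqrt_mult)
    also have "\<dots> \<le> a + t\<^sup>2 * (a + b) - 2 * t * sqrt (a * b)"
      using that by (simp add: mult_left_mono)
    finally show ?thesis by simp
  qed
  show ?thesis using *[OF assms(1,2)] *[OF assms(2,1)] by (simp add: abs_if mult.commute add.commute)
qed

lemma mean_le_sqrt_mult:
  fixes a b :: real
  assumes "0 \<le> a" "0 \<le> b"
  shows "(a + b) / 2 \<le> \<bar>a - b\<bar> / 2 + sqrt (a * b)"
proof -
  have *: "a \<le> sqrt (a * b)" if "0 \<le> a" "a \<le> b" for a b :: real
    using that by (intro real_le_rsqrt) (simp add: power2_eq_square mult_left_mono)
  show ?thesis using *[of a b] *[of b a] assms by (simp add: abs_if mult.commute)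
qed

lemma sqrt_minus_le:
  fixes a b c d :: real
  assumes "0 \<le> a" "0 \<le> b" "0 \<le> c" "0 \<le> d"
  shows "sqrt ((a * c + b * d) * (b * c + a * d)) \<le> sqrt (a * b) * (c + d) + sqrt (c * d) * (a + b)"
proof -
  have "(a * c + b * d) * (b * c + a * d) = a * b * (c\<^sup>2 + d\<^sup>2) + c * d * (a\<^sup>2 + b\<^sup>2)"
    by (simp add: power2_eq_square algebra_simps)
  also have "\<dots> \<le> a * b * (c + d)\<^sup>2 + c * d * (a + b)\<^sup>2"
    using assms by (intro add_mono mult_left_mono) (auto simp: power2_sum)
  finally have "sqrt ((a * c + b * d) * (b * c + a * d)) \<le> sqrt (a * b * (c + d)\<^sup>2 + c * d * (a + b)\<^sup>2)" by simp
  also have "\<dots> \<le> sqrt (a * b * (c + d)\<^sup>2) + sqrt (c * d * (a + b)\<^sup>2)"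
    using assms by (intro sqrt_add_le_add_sqrt) auto
  finally show ?thesis using assms by (simp add: real_sqrt_mult)
qed

lemma sqrt_minus_ge:
  fixes a b c d :: real
  assumes "0 \<le> a" "0 \<le> b" "0 \<le> c" "0 \<le> d"
  shows "sqrt (a * b) * (c + d) \<le> sqrt ((a * c + b * d) * (b * c + a * d))"
proof -
  have "a * b * (c + d)\<^sup>2 \<le> (a * c + b * d) * (b * c + a * d)"
  proof -
    have "0 \<le> c * d * (a - b)\<^sup>2" using assms by simp
    then show ?thesis by (simp add: power2_eq_square algebra_simps)
  qed
  then have "sqrt (a * b * (c + d)\<^sup>2) \<le> sqrt ((a * c + b * d) * (b * c + a * d))" by simp
  then show ?thesis using assms by (simp add: real_sqrt_mult)
qed

lemma abs_plus_le:
  fixes a b c d :: real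
  assumes "0 \<le> a" "0 \<le> b" "0 \<le> c" "0 \<le> d"
  shows "\<bar>a * c - b * d\<bar> + \<bar>b * c - a * d\<bar> \<le> \<bar>a - b\<bar> * (c + d) + (a + b) * \<bar>c - d\<bar>"
proof -
  define X Y where "X = (a - b) * (c + d)" and "Y = (a + b) * (c - d)"
  have "2 * (a * c - b * d) = X + Y" "2 * (b * c - a * d) = Y - X"
    by (simp_all add: X_def Y_def algebra_simps)
  moreover have "\<bar>u\<bar> + \<bar>v\<bar> \<le> \<bar>x\<bar> + \<bar>y\<bar>" if "2 * u = x + y" "2 * v = y - x" for u v x y :: real
    using that by (cases "0 \<le> u"; cases "0 \<le> v"; cases "0 \<le> x"; cases "0 \<le> y") simp_all
  ultimately have "\<bar>a * c - b * d\<bar> + \<bar>b * c - a * d\<bar> \<le> \<bar>X\<bar> + \<bar>Y\<bar>" by blast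
  then show ?thesis using assms by (simp add: X_def Y_def abs_mult)
qed

lemma abs_plus_ge:
  fixes a b c d :: real
  assumes "0 \<le> a" "0 \<le> b"
  shows "(a + b) * \<bar>c - d\<bar> \<le> \<bar>a * c - b * d\<bar> + \<bar>b * c - a * d\<bar>"
proof -
  have "(a + b) * \<bar>c - d\<bar> = \<bar>(a + b) * (c - d)\<bar>" using assms by (simp add: abs_mult)
  also have "(a + b) * (c - d) = (a * c - b * d) + (b * c - a * d)" by (simp add: algebra_simps)
  finally show ?thesis using abs_triangle_ineq by simp
qed

lemma ent_loss_chain:
  assumes "0 \<le> a" "0 \<le> b" "0 \<le> c" "0 \<le> d"
  shows "ent_loss (1/2 * (a * c + b * d)) (1/2 * (b * c + a * d))
       + (ent_loss (1/2 * (a * c)) (1/2 * (b * d)) + ent_loss (1/2 * (b * c)) (1/2 * (a * d)))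
       = 1/2 * (ent_loss a b * (c + d) + (a + b) * ent_loss c d)"
proof -
  define S where "S x = x * log 2 x" for x :: real
  have loss: "ent_loss x y = S (x + y) - S x - S y" for x y by (simp add: ent_loss_def S_def)
  have S_mult: "S (1/2 * (x * y)) = 1/2 * (y * S x + x * S y - x * y)" if "0 \<le> x" "0 \<le> y" for x y
    using that by (cases "x = 0 \<or> y = 0") (auto simp: S_def log_mult log_divide algebra_simps)
  have "1/2 * (a * c + b * d) + 1/2 * (b * c + a * d) = 1/2 * ((a + b) * (c + d))"
    "1/2 * (a * c) + 1/2 * (b * d) = 1/2 * (a * c + b * d)"
    "1/2 * (b * c) + 1/2 * (a * d) = 1/2 * (b * c + a * d)" by (simp_all add: algebra_simps)
  then have "ent_loss (1/2 * (a * c + b * d)) (1/2 * (b * c + a * d))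
       + (ent_loss (1/2 * (a * c)) (1/2 * (b * d)) + ent_loss (1/2 * (b * c)) (1/2 * (a * d)))
     = S (1/2 * ((a + b) * (c + d))) - S (1/2 * (a * c)) - S (1/2 * (b * d)) - S (1/2 * (b * c)) - S (1/2 * (a * d))"
    by (simp only: loss)
  also have "\<dots> = 1/2 * (ent_loss a b * (c + d) + (a + b) * ent_loss c d)"
    using assms by (simp only: S_mult add_nonneg_nonneg loss) (simp add: algebra_simps)
  finally show ?thesis .
qed

section \<open>Parameters of a binary-input channel\<close>

definition variation :: "'y channel \<Rightarrow> real" where
  "variation W = 1/2 * (\<integral>y. \<bar>tprob W 0 y - tprob W 1 y\<bar> \<partial>outs W)"

definition overlap :: "'y channel \<Rightarrow> real" where
  "overlap W = (\<integral>y. sqrt (tprob W 0 y * tprob W 1 y) \<partial>outs W)"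

definition equivocation :: "'y channel \<Rightarrow> real" where
  "equivocation W = 1/2 * (\<integral>y. ent_loss (tprob W 0 y) (tprob W 1 y) \<partial>outs W)"

locale binary_channel =
  fixes W :: "'y channel"
  assumes sigma_finite: "sigma_finite_measure (outs W)"
    and tprob_measurable [measurable]: "tprob W u \<in> borel_measurable (outs W)"
    and tprob_nonneg: "y \<in> space (outs W) \<Longrightarrow> 0 \<le> tprob W u y"
    and tprob_integrable [simp]: "integrable (outs W) (tprob W u)"
    and tprob_integral [simp]: "(\<integral>y. tprob W u y \<partial>outs W) = 1"

sublocale binary_channel \<subseteq> sigma_finite_measure "outs W"
  by (rule sigma_finite)

lemma bms_imp_binary_channel:
  assumes "bms_channel W"
  shows "binary_channel W"
proof (rule binary_channel.intro)
  show "sigma_finite_measure (outs W)" "tprob W u \<in> borel_measurable (outs W)"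
    and nonneg: "y \<in> space (outs W) \<Longrightarrow> 0 \<le> tprob W u y" for u y
    using assms by (auto simp: bms_channel_def)
  then have nn: "AE y in outs W. 0 \<le> tprob W u y" for u by (auto intro: AE_I2)
  have "(\<integral>\<^sup>+ y. ennreal (tprob W u y) \<partial>outs W) = ennreal 1" for u
    using assms by (auto simp: bms_channel_def)
  then have "has_bochner_integral (outs W) (tprob W u) 1" for u
    using nn \<open>\<And>u. tprob W u \<in> borel_measurable (outs W)\<close> by (intro has_bochner_integral_nn_integral) auto
  then show "integrable (outs W) (tprob W u)" "(\<integral>y. tprob W u y \<partial>outs W) = 1" for u
    by (auto simp: has_bochner_integral_iff)
qed

lemma ent_loss_measurable [measurable]:
  assumes [measurable]: "f \<in> borel_measurable M" "g \<in> borel_measurable M"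
  shows "(\<lambda>x. ent_loss (f x) (g x)) \<in> borel_measurable M"
  unfolding ent_loss_def by measurable

context binary_channel
begin

abbreviation "M \<equiv> outs W"
abbreviation "a \<equiv> tprob W 0"
abbreviation "b \<equiv> tprob W 1"

lemma integrable_abs_diff [simp]: "integrable M (\<lambda>y. \<bar>a y - b y\<bar>)"
  by simp

lemma integrable_sqrt [simp]: "integrable M (\<lambda>y. sqrt (a y * b y))"
proof (rule Bochner_Integration.integrable_bound)
  show "integrable M (\<lambda>y. a y + b y)" by simp
  show "AE y in M. norm (sqrt (a y * b y)) \<le> norm (a y + b y)"
  proof (rule AE_I2)
    fix y assume "y \<in> space M"
    then have "0 \<le> a y" "0 \<le> b y" by (simp_all add: tprob_nonneg)
    then show "norm (sqrt (a y * b y)) \<le> norm (a y + b y)"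
      using arith_geo_mean_sqrt[of "a y" "b y"] by simp
  qed
qed simp

lemma integrable_ent_loss [simp]: "integrable M (\<lambda>y. ent_loss (a y) (b y))"
proof (rule Bochner_Integration.integrable_bound)
  show "integrable M (\<lambda>y. 6 * sqrt (a y * b y))" by simp
  show "AE y in M. norm (ent_loss (a y) (b y)) \<le> norm (6 * sqrt (a y * b y))"
    by (rule AE_I2) (simp add: ent_loss_le ent_loss_nonneg tprob_nonneg)
qed simp

lemma variation_nonneg: "0 \<le> variation W"
  unfolding variation_def by (simp add: integral_nonneg)

lemma overlap_nonneg: "0 \<le> overlap W"
  unfolding overlap_def by (intro integral_nonneg_AE AE_I2) (simp add: tprob_nonneg)

lemma variation_eq: "variation W = 1 - 2 * ml_error W"
proof -
  have "min (a y) (b y) = (a y + b y - \<bar>a y - b y\<bar>) / 2" for y by (simp add: min_def)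
  then have "(\<integral>y. min (a y) (b y) \<partial>M) = (\<integral>y. (a y + b y - \<bar>a y - b y\<bar>) / 2 \<partial>M)" by (simp only:)
  also have "\<dots> = (1 + 1 - (\<integral>y. \<bar>a y - b y\<bar> \<partial>M)) / 2" by simp
  finally have "(\<integral>y. min (a y) (b y) \<partial>M) = (1 + 1 - (\<integral>y. \<bar>a y - b y\<bar> \<partial>M)) / 2" .
  then show ?thesis by (simp add: variation_def ml_error_def)
qed

lemma variation_overlap_ge_1: "1 \<le> variation W + overlap W"
proof -
  have "(\<integral>y. (a y + b y) / 2 \<partial>M) \<le> (\<integral>y. \<bar>a y - b y\<bar> / 2 + sqrt (a y * b y) \<partial>M)"
    by (intro integral_mono mean_le_sqrt_mult tprob_nonneg Bochner_Integration.integrable_add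
        integrable_divide_zero integrable_sqrt integrable_abs_diff) simp_all
  then show ?thesis by (simp add: variation_def overlap_def)
qed

lemma equivocation_ge: "1 - variation W \<le> equivocation W"
proof -
  have "(\<integral>y. a y + b y - \<bar>a y - b y\<bar> \<partial>M) \<le> (\<integral>y. ent_loss (a y) (b y) \<partial>M)"
    by (intro integral_mono ent_loss_ge tprob_nonneg) simp_all
  then show ?thesis by (simp add: variation_def equivocation_def)
qed

lemma equivocation_le: "equivocation W \<le> 3 * overlap W"
proof -
  have "(\<integral>y. ent_loss (a y) (b y) \<partial>M) \<le> (\<integral>y. 6 * sqrt (a y * b y) \<partial>M)"
    by (intro integral_mono ent_loss_le tprob_nonneg) simp_all
  then show ?thesis by (simp add: overlap_def equivocation_def)
qed

lemma equivocation_le_mean: "2 * equivocation W \<le> 1 + overlap W"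
proof -
  have "(\<integral>y. ent_loss (a y) (b y) \<partial>M) \<le> (\<integral>y. (a y + b y) / 2 + sqrt (a y * b y) \<partial>M)"
    by (intro integral_mono ent_loss_le_mean tprob_nonneg) simp_all
  then show ?thesis by (simp add: overlap_def equivocation_def)
qed

lemma overlap_le: "overlap W \<le> 1 - (variation W)\<^sup>2 / 2"
proof -
  define t where "t = variation W"
  have "(\<integral>y. sqrt (a y * b y) \<partial>M)
      \<le> (\<integral>y. (a y + b y) / 2 - (2 * t * \<bar>a y - b y\<bar> - t\<^sup>2 * (a y + b y)) / 4 \<partial>M)"
    by (intro integral_mono sqrt_mult_le tprob_nonneg) simp_all
  also have "\<dots> = 1 - (2 * t * (2 * t) - t\<^sup>2 * 2) / 4"
    by (simp add: t_def variation_def)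
  finally show ?thesis by (simp add: overlap_def t_def [symmetric] power2_eq_square)
qed

lemma variation_le: "variation W \<le> 1 - (overlap W)\<^sup>2 / 2"
proof -
  define t where "t = overlap W / 2"
  have "(\<integral>y. 2 * t * sqrt (a y * b y) \<partial>M) \<le> (\<integral>y. (a y + b y - \<bar>a y - b y\<bar>) / 2 + t\<^sup>2 * (a y + b y) \<partial>M)"
    using overlap_nonneg by (intro integral_mono sqrt_mult_le' tprob_nonneg) (simp_all add: t_def)
  then have "2 * t * overlap W \<le> 1 - variation W + 2 * t\<^sup>2"
    by (simp add: variation_def overlap_def field_simps)
  then show ?thesis by (simp add: t_def power2_eq_square)
qed

lemma
  assumes f: "integrable M f" and g: "integrable M g"
  shows integrable_prod: "integrable (M \<Otimes>\<^sub>M M) (\<lambda>(x, y). f x * g y)"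
    and integral_prod: "(\<integral>(x, y). f x * g y \<partial>(M \<Otimes>\<^sub>M M)) = (\<integral>x. f x \<partial>M) * (\<integral>y. g y \<partial>M :: real)"
proof -
  interpret P: pair_sigma_finite M M ..
  have [measurable]: "f \<in> borel_measurable M" "g \<in> borel_measurable M" using f g by auto
  show int: "integrable (M \<Otimes>\<^sub>M M) (\<lambda>(x, y). f x * g y)"
  proof (rule P.Fubini_integrable)
    show "integrable M (\<lambda>x. \<integral>y. norm (case (x, y) of (x, y) \<Rightarrow> f x * g y) \<partial>M)"
      using f g by (simp add: abs_mult)
  qed (use f g in simp_all)
  show "(\<integral>(x, y). f x * g y \<partial>(M \<Otimes>\<^sub>M M)) = (\<integral>x. f x \<partial>M) * (\<integral>y. g y \<partial>M)"
    using P.integral_fst'[OF int] by simp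
qed

end

lemma UNIV_bit: "(UNIV :: bit set) = {0, 1}"
  by (auto intro: bit.exhaust)

lemma sigma_finite_bit: "sigma_finite_measure (count_space (UNIV :: bit set))"
  by (intro sigma_finite_measure_count_space_finite) (simp add: UNIV_bit)

lemma nn_integral_bit:
  assumes "sigma_finite_measure M" and [measurable]: "h \<in> borel_measurable (M \<Otimes>\<^sub>M (M \<Otimes>\<^sub>M count_space (UNIV :: bit set)))"
  shows "(\<integral>\<^sup>+ z. h z \<partial>(M \<Otimes>\<^sub>M (M \<Otimes>\<^sub>M count_space UNIV))) = (\<integral>\<^sup>+ (x, y). h (x, y, 0) + h (x, y, 1) \<partial>(M \<Otimes>\<^sub>M M))"
proof -
  interpret M: sigma_finite_measure M by fact
  interpret B: sigma_finite_measure "count_space (UNIV :: bit set)" by (rule sigma_finite_bit)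
  interpret MB: sigma_finite_measure "M \<Otimes>\<^sub>M count_space (UNIV :: bit set)"
    by (intro sigma_finite_pair_measure assms sigma_finite_bit)
  have "(\<integral>\<^sup>+ z. h z \<partial>(M \<Otimes>\<^sub>M (M \<Otimes>\<^sub>M count_space UNIV)))
      = (\<integral>\<^sup>+ x. \<integral>\<^sup>+ q. h (x, q) \<partial>(M \<Otimes>\<^sub>M count_space UNIV) \<partial>M)"
    by (simp add: MB.nn_integral_fst)
  also have "\<dots> = (\<integral>\<^sup>+ x. \<integral>\<^sup>+ y. \<integral>\<^sup>+ u. h (x, y, u) \<partial>count_space UNIV \<partial>M \<partial>M)"
    by (intro nn_integral_cong) (simp add: B.nn_integral_fst [symmetric])
  also have "\<dots> = (\<integral>\<^sup>+ x. \<integral>\<^sup>+ y. h (x, y, 0) + h (x, y, 1) \<partial>M \<partial>M)"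
    by (simp add: nn_integral_count_space_finite UNIV_bit)
  also have "\<dots> = (\<integral>\<^sup>+ (x, y). h (x, y, 0) + h (x, y, 1) \<partial>(M \<Otimes>\<^sub>M M))"
    by (simp add: M.nn_integral_fst [symmetric])
  finally show ?thesis .
qed

lemma has_bochner_integral_bit:
  fixes h :: "'y \<times> 'y \<times> bit \<Rightarrow> real"
  assumes "sigma_finite_measure M" and [measurable]: "h \<in> borel_measurable (M \<Otimes>\<^sub>M (M \<Otimes>\<^sub>M count_space UNIV))"
    and nonneg: "\<And>x y u. x \<in> space M \<Longrightarrow> y \<in> space M \<Longrightarrow> 0 \<le> h (x, y, u)"
    and int: "\<And>u. integrable (M \<Otimes>\<^sub>M M) (\<lambda>(x, y). h (x, y, u))"
  shows "has_bochner_integral (M \<Otimes>\<^sub>M (M \<Otimes>\<^sub>M count_space UNIV)) h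
     (\<integral>(x, y). h (x, y, 0) + h (x, y, 1) \<partial>(M \<Otimes>\<^sub>M M))"
proof (rule has_bochner_integral_nn_integral)
  have sum: "integrable (M \<Otimes>\<^sub>M M) (\<lambda>(x, y). h (x, y, 0) + h (x, y, 1))"
    using Bochner_Integration.integrable_add[OF int[of 0] int[of 1]] by (simp add: case_prod_beta')
  show "AE z in M \<Otimes>\<^sub>M (M \<Otimes>\<^sub>M count_space UNIV). 0 \<le> h z"
    using nonneg by (intro AE_I2) (auto simp: space_pair_measure)
  show "0 \<le> (\<integral>(x, y). h (x, y, 0) + h (x, y, 1) \<partial>(M \<Otimes>\<^sub>M M))"
    using nonneg by (intro integral_nonneg_AE AE_I2) (auto simp: space_pair_measure)
  have "(\<integral>\<^sup>+ z. ennreal (h z) \<partial>(M \<Otimes>\<^sub>M (M \<Otimes>\<^sub>M count_space UNIV)))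
      = (\<integral>\<^sup>+ (x, y). ennreal (h (x, y, 0)) + ennreal (h (x, y, 1)) \<partial>(M \<Otimes>\<^sub>M M))"
    by (intro nn_integral_bit assms(1)) measurable
  also have "\<dots> = (\<integral>\<^sup>+ z. ennreal (case z of (x, y) \<Rightarrow> h (x, y, 0) + h (x, y, 1)) \<partial>(M \<Otimes>\<^sub>M M))"
    using nonneg by (intro nn_integral_cong) (auto simp: space_pair_measure)
  also have "\<dots> = ennreal (\<integral>(x, y). h (x, y, 0) + h (x, y, 1) \<partial>(M \<Otimes>\<^sub>M M))"
    using nonneg by (intro nn_integral_eq_integral sum AE_I2) (auto simp: space_pair_measure)
  finally show "(\<integral>\<^sup>+ z. ennreal (h z) \<partial>(M \<Otimes>\<^sub>M (M \<Otimes>\<^sub>M count_space UNIV)))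
      = ennreal (\<integral>(x, y). h (x, y, 0) + h (x, y, 1) \<partial>(M \<Otimes>\<^sub>M M))" .
qed fact

lemma
  fixes g :: "'a \<Rightarrow> real"
  assumes "inj f" and [measurable]: "g \<in> borel_measurable M"
  shows measurable_embed_inv: "(\<lambda>z. g (inv_into UNIV f z)) \<in> borel_measurable (embed_measure M f)"
    and integral_embed_inv: "(\<integral>z. g (inv_into UNIV f z) \<partial>embed_measure M f) = (\<integral>x. g x \<partial>M)"
    and integrable_embed_inv: "integrable (embed_measure M f) (\<lambda>z. g (inv_into UNIV f z)) \<longleftrightarrow> integrable M g"
proof -
  show meas: "(\<lambda>z. g (inv_into UNIV f z)) \<in> borel_measurable (embed_measure M f)"
    by (rule measurable_embed_measure1) (simp add: assms)
  note * = measurable_embed_measure2[OF assms(1), of M]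
  show "(\<integral>z. g (inv_into UNIV f z) \<partial>embed_measure M f) = (\<integral>x. g x \<partial>M)"
    by (subst embed_measure_eq_distr[OF assms(1)]) (simp add: integral_distr[OF * meas] assms(1))
  show "integrable (embed_measure M f) (\<lambda>z. g (inv_into UNIV f z)) \<longleftrightarrow> integrable M g"
    by (subst embed_measure_eq_distr[OF assms(1)]) (simp add: integrable_distr_eq[OF * meas] assms(1))
qed

context
  fixes W :: "'y channel" and f :: "'y \<Rightarrow> 'z"
  assumes W: "binary_channel W" and f: "inj f"
begin

interpretation binary_channel W by (rule W)

lemma binary_channel_relabel: "binary_channel (relabel f W)"
proof (rule binary_channel.intro)
  show "sigma_finite_measure (outs (relabel f W))"
    using sigma_finite_embed_measure[OF sigma_finite f] by (simp add: relabel_def)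
  show "tprob (relabel f W) u \<in> borel_measurable (outs (relabel f W))" for u
    using measurable_embed_inv[OF f tprob_measurable] by (simp add: relabel_def)
  show "0 \<le> tprob (relabel f W) u y" if "y \<in> space (outs (relabel f W))" for u y
    using that f by (auto simp: relabel_def space_embed_measure tprob_nonneg)
  show "integrable (outs (relabel f W)) (tprob (relabel f W) u)" for u
    using integrable_embed_inv[OF f tprob_measurable] by (simp add: relabel_def)
  show "(\<integral>y. tprob (relabel f W) u y \<partial>outs (relabel f W)) = 1" for u
    using integral_embed_inv[OF f tprob_measurable] by (simp add: relabel_def)
qed

lemma variation_relabel: "variation (relabel f W) = variation W"
  using integral_embed_inv[OF f, of "\<lambda>y. \<bar>a y - b y\<bar>" M] by (simp add: variation_def relabel_def)

lemma overlap_relabel: "overlap (relabel f W) = overlap W"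
  using integral_embed_inv[OF f, of "\<lambda>y. sqrt (a y * b y)" M] by (simp add: overlap_def relabel_def)

lemma equivocation_relabel: "equivocation (relabel f W) = equivocation W"
  using integral_embed_inv[OF f, of "\<lambda>y. ent_loss (a y) (b y)" M] by (simp add: equivocation_def relabel_def)

end

context binary_channel
begin

lemma outs_minus: "outs (chan_minus W) = M \<Otimes>\<^sub>M M"
  by (simp add: chan_minus_def)

lemma tprob_minus:
  "tprob (chan_minus W) 0 = (\<lambda>(x, y). 1/2 * (a x * a y + b x * b y))"
  "tprob (chan_minus W) 1 = (\<lambda>(x, y). 1/2 * (b x * a y + a x * b y))"
  by (auto simp: chan_minus_def UNIV_bit)

lemma outs_plus: "outs (chan_plus W) = M \<Otimes>\<^sub>M (M \<Otimes>\<^sub>M count_space UNIV)"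
  by (simp add: chan_plus_def)

lemma tprob_plus:
  "tprob (chan_plus W) v (x, y, u) = 1/2 * (tprob W (u + v) x * tprob W v y)"
  by (simp add: chan_plus_def)

lemma bit_cases: "(u :: bit) = 0 \<or> u = 1"
  using UNIV_bit by blast

text \<open>Single products are brought into the following form with \<open>0 * 0\<close> as second summand.\<close>

lemma integrable_prod_2:
  assumes "integrable M f" "integrable M g" "integrable M h" "integrable M k"
  shows "integrable (M \<Otimes>\<^sub>M M) (\<lambda>(x, y). c * (f x * g y + h x * k y) :: real)"
  using Bochner_Integration.integrable_add[OF integrable_prod[OF assms(1,2)] integrable_prod[OF assms(3,4)]]
  by (auto simp: case_prod_beta')

lemma integral_prod_2:
  assumes "integrable M f" "integrable M g" "integrable M h" "integrable M k"
  shows "(\<integral>(x, y). c * (f x * g y + h x * k y) \<partial>(M \<Otimes>\<^sub>M M)) =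
    c * ((\<integral>x. f x \<partial>M) * (\<integral>y. g y \<partial>M) + (\<integral>x. h x \<partial>M) * (\<integral>y. k y \<partial>M) :: real)"
  using Bochner_Integration.integral_add[OF integrable_prod[OF assms(1,2)] integrable_prod[OF assms(3,4)]]
    integral_prod[OF assms(1,2)] integral_prod[OF assms(3,4)]
  by (simp add: case_prod_beta')

lemma sigma_finite_prod: "sigma_finite_measure (M \<Otimes>\<^sub>M M)"
  by (intro sigma_finite_pair_measure sigma_finite)

lemma binary_channel_minus: "binary_channel (chan_minus W)"
proof (rule binary_channel.intro)
  show "sigma_finite_measure (outs (chan_minus W))"
    by (simp add: outs_minus sigma_finite_prod)
  fix u :: bit
  have "integrable (outs (chan_minus W)) (tprob (chan_minus W) u) \<and>
      (\<integral>z. tprob (chan_minus W) u z \<partial>outs (chan_minus W)) = 1"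
    using bit_cases[of u] integrable_prod_2[of a a b b "1/2"] integrable_prod_2[of b a a b "1/2"]
      integral_prod_2[of a a b b "1/2"] integral_prod_2[of b a a b "1/2"]
    by (auto simp: tprob_minus outs_minus)
  then show "integrable (outs (chan_minus W)) (tprob (chan_minus W) u)"
    "(\<integral>z. tprob (chan_minus W) u z \<partial>outs (chan_minus W)) = 1" by auto
  then show "tprob (chan_minus W) u \<in> borel_measurable (outs (chan_minus W))" by auto
  show "0 \<le> tprob (chan_minus W) u z" if "z \<in> space (outs (chan_minus W))" for z
    using that bit_cases[of u] by (auto simp: outs_minus tprob_minus space_pair_measure tprob_nonneg)
qed

lemma variation_minus: "variation (chan_minus W) = (variation W)\<^sup>2"
proof -
  have "\<bar>1/2 * (a x * a y + b x * b y) - 1/2 * (b x * a y + a x * b y)\<bar>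
      = 1/2 * (\<bar>a x - b x\<bar> * \<bar>a y - b y\<bar> + 0 * 0)" for x y
  proof -
    have "1/2 * (a x * a y + b x * b y) - 1/2 * (b x * a y + a x * b y) = 1/2 * ((a x - b x) * (a y - b y))"
      by (simp add: algebra_simps)
    then show ?thesis by (simp only: abs_mult) simp
  qed
  then have "variation (chan_minus W)
      = 1/2 * (\<integral>(x, y). 1/2 * (\<bar>a x - b x\<bar> * \<bar>a y - b y\<bar> + 0 * 0) \<partial>(M \<Otimes>\<^sub>M M))"
    by (simp only: variation_def outs_minus tprob_minus case_prod_beta')
  also have "\<dots> = (variation W)\<^sup>2"
    by (subst integral_prod_2) (simp_all add: variation_def power2_eq_square)
  finally show ?thesis .
qed

lemma overlap_minus_le: "overlap (chan_minus W) \<le> 2 * overlap W"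
  and overlap_minus_ge: "overlap W \<le> overlap (chan_minus W)"
proof -
  interpret N: binary_channel "chan_minus W" by (rule binary_channel_minus)
  define s where "s y = sqrt (a y * b y)" for y
  have int: "integrable M s" "(\<integral>y. s y \<partial>M) = overlap W" by (simp_all add: s_def[abs_def] overlap_def)
  have half: "sqrt (1/2 * p * (1/2 * q)) = 1/2 * sqrt (p * q)" for p q :: real
  proof -
    have "1/2 * p * (1/2 * q) = (1/2)\<^sup>2 * (p * q)" by (simp add: power2_eq_square)
    then have "sqrt (1/2 * p * (1/2 * q)) = sqrt ((1/2)\<^sup>2 * (p * q))" by (simp only:)
    then show ?thesis by (simp add: real_sqrt_mult)
  qed
  have "overlap (chan_minus W) \<le> (\<integral>(x, y). 1/2 * (s x * (a y + b y) + (a x + b x) * s y) \<partial>(M \<Otimes>\<^sub>M M))"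
    unfolding overlap_def outs_minus
  proof (rule integral_mono)
    show "integrable (M \<Otimes>\<^sub>M M) (\<lambda>z. sqrt (tprob (chan_minus W) 0 z * tprob (chan_minus W) 1 z))"
      using N.integrable_sqrt by (simp only: outs_minus)
    show "integrable (M \<Otimes>\<^sub>M M) (\<lambda>(x, y). 1/2 * (s x * (a y + b y) + (a x + b x) * s y))"
      by (intro integrable_prod_2 int) simp_all
    fix z assume "z \<in> space (M \<Otimes>\<^sub>M M)"
    then obtain x y where z: "z = (x, y)" "x \<in> space M" "y \<in> space M" by (auto simp: space_pair_measure)
    then show "sqrt (tprob (chan_minus W) 0 z * tprob (chan_minus W) 1 z)
        \<le> (case z of (x, y) \<Rightarrow> 1/2 * (s x * (a y + b y) + (a x + b x) * s y))"
      using sqrt_minus_le[of "a x" "b x" "a y" "b y"]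
      by (simp add: tprob_minus half s_def tprob_nonneg mult.commute del: times_divide_eq_left)
  qed
  also have "\<dots> = 2 * overlap W"
    by (subst integral_prod_2) (simp_all add: int)
  finally show "overlap (chan_minus W) \<le> 2 * overlap W" .
  have "overlap W = (\<integral>(x, y). 1/2 * (s x * (a y + b y) + 0 * 0) \<partial>(M \<Otimes>\<^sub>M M))"
    by (subst integral_prod_2) (simp_all add: int)
  also have "\<dots> \<le> overlap (chan_minus W)"
    unfolding overlap_def outs_minus
  proof (rule integral_mono)
    show "integrable (M \<Otimes>\<^sub>M M) (\<lambda>z. sqrt (tprob (chan_minus W) 0 z * tprob (chan_minus W) 1 z))"
      using N.integrable_sqrt by (simp only: outs_minus)
    show "integrable (M \<Otimes>\<^sub>M M) (\<lambda>(x, y). 1/2 * (s x * (a y + b y) + 0 * 0))"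
      by (intro integrable_prod_2 int) simp_all
    fix z assume "z \<in> space (M \<Otimes>\<^sub>M M)"
    then obtain x y where z: "z = (x, y)" "x \<in> space M" "y \<in> space M" by (auto simp: space_pair_measure)
    then show "(case z of (x, y) \<Rightarrow> 1/2 * (s x * (a y + b y) + 0 * 0))
        \<le> sqrt (tprob (chan_minus W) 0 z * tprob (chan_minus W) 1 z)"
      using sqrt_minus_ge[of "a x" "b x" "a y" "b y"]
      by (simp add: tprob_minus half s_def tprob_nonneg mult.commute del: times_divide_eq_left)
  qed
  finally show "overlap W \<le> overlap (chan_minus W)" .
qed

lemma plus_fiber:
  assumes [measurable]: "h \<in> borel_measurable (outs (chan_plus W))"
    and "\<And>x y u. x \<in> space M \<Longrightarrow> y \<in> space M \<Longrightarrow> 0 \<le> h (x, y, u)"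
    and "\<And>u. integrable (M \<Otimes>\<^sub>M M) (\<lambda>(x, y). h (x, y, u) :: real)"
  shows "integrable (outs (chan_plus W)) h"
    and "(\<integral>z. h z \<partial>outs (chan_plus W)) = (\<integral>(x, y). h (x, y, 0) + h (x, y, 1) \<partial>(M \<Otimes>\<^sub>M M))"
  using has_bochner_integral_bit[OF sigma_finite, of h] assms
  unfolding outs_plus has_bochner_integral_iff by blast+

lemma tprob_plus_measurable [measurable]: "tprob (chan_plus W) v \<in> borel_measurable (outs (chan_plus W))"
proof -
  have 1: "(\<lambda>z. tprob W (snd (snd z) + v) (fst z)) \<in> borel_measurable (outs (chan_plus W))"
  proof -
    have "(\<lambda>z. if snd (snd z) = v then a (fst z) else b (fst z)) \<in> borel_measurable (outs (chan_plus W))"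
      unfolding outs_plus by measurable
    moreover have "tprob W (u + v) y = (if u = v then a y else b y)" for u y
      using bit_cases[of u] bit_cases[of v] by auto
    ultimately show ?thesis by simp
  qed
  have 2: "(\<lambda>z. tprob W v (fst (snd z))) \<in> borel_measurable (outs (chan_plus W))"
    unfolding outs_plus by measurable
  have "tprob (chan_plus W) v = (\<lambda>z. 1/2 * (tprob W (snd (snd z) + v) (fst z) * tprob W v (fst (snd z))))"
    by (auto simp: tprob_plus)
  then show ?thesis by (simp only:) (intro borel_measurable_times borel_measurable_const 1 2)
qed

lemma binary_channel_plus: "binary_channel (chan_plus W)"
proof (rule binary_channel.intro)
  show "sigma_finite_measure (outs (chan_plus W))"
    unfolding outs_plus by (intro sigma_finite_pair_measure sigma_finite sigma_finite_bit)
  fix v :: bit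
  show "tprob (chan_plus W) v \<in> borel_measurable (outs (chan_plus W))" by measurable
  show "0 \<le> tprob (chan_plus W) v z" if "z \<in> space (outs (chan_plus W))" for z
    using that by (auto simp: outs_plus tprob_plus space_pair_measure tprob_nonneg)
  have int: "integrable (M \<Otimes>\<^sub>M M) (\<lambda>(x, y). tprob (chan_plus W) v (x, y, u))" for u
    using integrable_prod_2[of "tprob W (u + v)" "tprob W v" "\<lambda>_. 0" "\<lambda>_. 0" "1/2"]
    by (simp add: tprob_plus)
  note fiber = plus_fiber[OF tprob_plus_measurable _ int]
  show "integrable (outs (chan_plus W)) (tprob (chan_plus W) v)"
    by (rule fiber) (simp add: tprob_plus tprob_nonneg)
  have "(\<integral>z. tprob (chan_plus W) v z \<partial>outs (chan_plus W))
      = (\<integral>(x, y). 1/2 * (tprob W (0 + v) x * tprob W v y + tprob W (1 + v) x * tprob W v y) \<partial>(M \<Otimes>\<^sub>M M))"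
    by (subst fiber) (simp_all add: tprob_plus tprob_nonneg algebra_simps)
  also have "\<dots> = 1" by (subst integral_prod_2) simp_all
  finally show "(\<integral>z. tprob (chan_plus W) v z \<partial>outs (chan_plus W)) = 1" .
qed

lemma overlap_plus: "overlap (chan_plus W) = (overlap W)\<^sup>2"
proof -
  define s where "s y = sqrt (a y * b y)" for y
  have int: "integrable M s" "(\<integral>y. s y \<partial>M) = overlap W" by (simp_all add: s_def[abs_def] overlap_def)
  define h where "h z = sqrt (tprob (chan_plus W) 0 z * tprob (chan_plus W) 1 z)" for z
  have h: "h (x, y, u) = 1/2 * (s x * s y + 0 * 0)" for x y u
  proof -
    have "tprob (chan_plus W) 0 (x, y, u) * tprob (chan_plus W) 1 (x, y, u)
        = (1/2)\<^sup>2 * ((a x * b x) * (a y * b y))"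
      using bit_cases[of u] by (auto simp: tprob_plus power2_eq_square)
    then show ?thesis unfolding h_def s_def by (simp only: real_sqrt_mult real_sqrt_abs) simp
  qed
  have int_h: "integrable (M \<Otimes>\<^sub>M M) (\<lambda>(x, y). h (x, y, u))" for u
    unfolding h by (intro integrable_prod_2 int) simp_all
  have "overlap (chan_plus W) = (\<integral>(x, y). h (x, y, 0) + h (x, y, 1) \<partial>(M \<Otimes>\<^sub>M M))"
    unfolding overlap_def h_def[symmetric]
    by (rule plus_fiber(2)[OF _ _ int_h]) (simp_all add: h_def[abs_def] tprob_plus tprob_nonneg)
  also have "\<dots> = (\<integral>(x, y). 1 * (s x * s y + 0 * 0) \<partial>(M \<Otimes>\<^sub>M M))" unfolding h by simp
  also have "\<dots> = (overlap W)\<^sup>2"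
    by (subst integral_prod_2) (simp_all add: int power2_eq_square)
  finally show ?thesis .
qed

lemma abs_diff_plus:
  "\<bar>tprob (chan_plus W) 0 (x, y, 0) - tprob (chan_plus W) 1 (x, y, 0)\<bar> = 1/2 * \<bar>a x * a y - b x * b y\<bar>"
  "\<bar>tprob (chan_plus W) 0 (x, y, 1) - tprob (chan_plus W) 1 (x, y, 1)\<bar> = 1/2 * \<bar>b x * a y - a x * b y\<bar>"
proof -
  have half: "\<bar>1/2 * p - 1/2 * q\<bar> = 1/2 * \<bar>p - q\<bar>" for p q :: real
    by (simp add: abs_if)
  show "\<bar>tprob (chan_plus W) 0 (x, y, 0) - tprob (chan_plus W) 1 (x, y, 0)\<bar> = 1/2 * \<bar>a x * a y - b x * b y\<bar>"
    "\<bar>tprob (chan_plus W) 0 (x, y, 1) - tprob (chan_plus W) 1 (x, y, 1)\<bar> = 1/2 * \<bar>b x * a y - a x * b y\<bar>"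
    unfolding tprob_plus half by simp_all
qed

lemma variation_plus_le: "variation (chan_plus W) \<le> 2 * variation W"
  and variation_plus_ge: "variation W \<le> variation (chan_plus W)"
proof -
  define d where "d y = \<bar>a y - b y\<bar>" for y
  have int: "integrable M d" "(\<integral>y. d y \<partial>M) = 2 * variation W"
    by (simp_all add: d_def[abs_def] variation_def)
  define h where "h z = \<bar>tprob (chan_plus W) 0 z - tprob (chan_plus W) 1 z\<bar>" for z
  have int_h: "integrable (M \<Otimes>\<^sub>M M) (\<lambda>(x, y). h (x, y, u))" for u
  proof -
    have "integrable (M \<Otimes>\<^sub>M M) (\<lambda>z. \<bar>case z of (x, y) \<Rightarrow> 1/2 * (tprob W u x * a y + (- tprob W (u + 1) x) * b y)\<bar>)"
      by (intro integrable_abs integrable_prod_2) simp_all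
    moreover have "h (x, y, u) = \<bar>1/2 * (tprob W u x * a y + (- tprob W (u + 1) x) * b y)\<bar>" for x y
      unfolding h_def tprob_plus by (simp add: right_diff_distrib)
    ultimately show ?thesis by (simp only: case_prod_beta' prod.collapse)
  qed
  have sum: "integrable (M \<Otimes>\<^sub>M M) (\<lambda>(x, y). h (x, y, 0) + h (x, y, 1))"
    using Bochner_Integration.integrable_add[OF int_h[of 0] int_h[of 1]] by (simp add: case_prod_beta')
  have eq: "variation (chan_plus W) = 1/2 * (\<integral>(x, y). h (x, y, 0) + h (x, y, 1) \<partial>(M \<Otimes>\<^sub>M M))"
    unfolding variation_def h_def[symmetric]
    by (subst plus_fiber(2)[OF _ _ int_h]) (simp_all add: h_def[abs_def])
  have h: "h (x, y, 0) + h (x, y, 1) = 1/2 * (\<bar>a x * a y - b x * b y\<bar> + \<bar>b x * a y - a x * b y\<bar>)" for x y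
    unfolding h_def abs_diff_plus by simp
  have "(\<integral>(x, y). h (x, y, 0) + h (x, y, 1) \<partial>(M \<Otimes>\<^sub>M M))
      \<le> (\<integral>(x, y). 1/2 * (d x * (a y + b y) + (a x + b x) * d y) \<partial>(M \<Otimes>\<^sub>M M))"
  proof (rule integral_mono[OF sum])
    show "integrable (M \<Otimes>\<^sub>M M) (\<lambda>(x, y). 1/2 * (d x * (a y + b y) + (a x + b x) * d y))"
      by (intro integrable_prod_2 int) simp_all
    fix z assume "z \<in> space (M \<Otimes>\<^sub>M M)"
    then obtain x y where z: "z = (x, y)" "x \<in> space M" "y \<in> space M" by (auto simp: space_pair_measure)
    show "(case z of (x, y) \<Rightarrow> h (x, y, 0) + h (x, y, 1))
        \<le> (case z of (x, y) \<Rightarrow> 1/2 * (d x * (a y + b y) + (a x + b x) * d y))"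
      using abs_plus_le[of "a x" "b x" "a y" "b y"] z by (simp add: h d_def tprob_nonneg)
  qed
  also have "\<dots> = 4 * variation W" by (subst integral_prod_2) (simp_all add: int)
  finally show "variation (chan_plus W) \<le> 2 * variation W" by (simp add: eq)
  have "2 * variation W = (\<integral>(x, y). 1/2 * ((a x + b x) * d y + 0 * 0) \<partial>(M \<Otimes>\<^sub>M M))"
    by (subst integral_prod_2) (simp_all add: int)
  also have "\<dots> \<le> (\<integral>(x, y). h (x, y, 0) + h (x, y, 1) \<partial>(M \<Otimes>\<^sub>M M))"
  proof (rule integral_mono[OF _ sum])
    show "integrable (M \<Otimes>\<^sub>M M) (\<lambda>(x, y). 1/2 * ((a x + b x) * d y + 0 * 0))"
      by (intro integrable_prod_2 int) simp_all
    fix z assume "z \<in> space (M \<Otimes>\<^sub>M M)"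
    then obtain x y where z: "z = (x, y)" "x \<in> space M" "y \<in> space M" by (auto simp: space_pair_measure)
    show "(case z of (x, y) \<Rightarrow> 1/2 * ((a x + b x) * d y + 0 * 0))
        \<le> (case z of (x, y) \<Rightarrow> h (x, y, 0) + h (x, y, 1))"
      using abs_plus_ge[of "a x" "b x" "a y" "b y"] z by (simp add: h d_def tprob_nonneg)
  qed
  finally show "variation W \<le> variation (chan_plus W)" by (simp add: eq)
qed

lemma equivocation_split: "equivocation (chan_minus W) + equivocation (chan_plus W) = 2 * equivocation W"
proof -
  interpret N: binary_channel "chan_minus W" by (rule binary_channel_minus)
  define e where "e y = ent_loss (a y) (b y)" for y
  have int: "integrable M e" "(\<integral>y. e y \<partial>M) = 2 * equivocation W"
    by (simp_all add: e_def[abs_def] equivocation_def)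
  define g where "g z = ent_loss (tprob (chan_minus W) 0 z) (tprob (chan_minus W) 1 z)" for z
  define h where "h z = ent_loss (tprob (chan_plus W) 0 z) (tprob (chan_plus W) 1 z)" for z
  define r where "r = (\<lambda>(x, y). 1/2 * (e x * (a y + b y) + (a x + b x) * e y))"
  have int_g: "integrable (M \<Otimes>\<^sub>M M) g"
    using N.integrable_ent_loss by (simp add: g_def[abs_def] outs_minus)
  have int_r: "integrable (M \<Otimes>\<^sub>M M) r" "(\<integral>z. r z \<partial>(M \<Otimes>\<^sub>M M)) = 4 * equivocation W"
    unfolding r_def by (rule integrable_prod_2 int; simp add: int)
      (subst integral_prod_2, simp_all add: int)
  have chain: "g (x, y) + (h (x, y, 0) + h (x, y, 1)) = r (x, y)" if "x \<in> space M" "y \<in> space M" for x y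
    using ent_loss_chain[of "a x" "b x" "a y" "b y"] that
    by (simp only: g_def h_def r_def e_def tprob_minus tprob_plus tprob_nonneg case_prod_conv add_0_left)
      (simp add: add.commute)
  have h_nonneg: "0 \<le> h (x, y, u)" if "x \<in> space M" "y \<in> space M" for x y u
    using that by (auto simp: h_def tprob_plus tprob_nonneg intro!: ent_loss_nonneg)
  have g_nonneg: "0 \<le> g (x, y)" if "x \<in> space M" "y \<in> space M" for x y
    using that by (auto simp: g_def tprob_minus tprob_nonneg intro!: ent_loss_nonneg)
  have h_meas [measurable]: "h \<in> borel_measurable (outs (chan_plus W))" unfolding h_def[abs_def] by measurable
  have int_h: "integrable (M \<Otimes>\<^sub>M M) (\<lambda>(x, y). h (x, y, u))" for u
  proof (rule Bochner_Integration.integrable_bound[OF int_r(1)])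
    have [measurable]: "h \<in> borel_measurable (M \<Otimes>\<^sub>M (M \<Otimes>\<^sub>M count_space UNIV))"
      using h_meas by (simp add: outs_plus)
    show "(\<lambda>(x, y). h (x, y, u)) \<in> borel_measurable (M \<Otimes>\<^sub>M M)" by measurable
    show "AE z in M \<Otimes>\<^sub>M M. norm (case z of (x, y) \<Rightarrow> h (x, y, u)) \<le> norm (r z)"
    proof (rule AE_I2)
      fix z assume "z \<in> space (M \<Otimes>\<^sub>M M)"
      then obtain x y where z: "z = (x, y)" "x \<in> space M" "y \<in> space M" by (auto simp: space_pair_measure)
      then show "norm (case z of (x, y) \<Rightarrow> h (x, y, u)) \<le> norm (r z)"
        using chain[OF z(2,3)] g_nonneg[OF z(2,3)] h_nonneg[OF z(2,3), of 0] h_nonneg[OF z(2,3), of 1]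
          bit_cases[of u] by auto
    qed
  qed
  have sum: "integrable (M \<Otimes>\<^sub>M M) (\<lambda>(x, y). h (x, y, 0) + h (x, y, 1))"
    using Bochner_Integration.integrable_add[OF int_h[of 0] int_h[of 1]] by (simp add: case_prod_beta')
  have "2 * equivocation (chan_plus W) = (\<integral>(x, y). h (x, y, 0) + h (x, y, 1) \<partial>(M \<Otimes>\<^sub>M M))"
    unfolding equivocation_def h_def[symmetric]
    by (subst plus_fiber(2)[OF h_meas _ int_h]) (simp_all add: h_nonneg)
  moreover have "2 * equivocation (chan_minus W) = (\<integral>z. g z \<partial>(M \<Otimes>\<^sub>M M))"
    by (simp add: equivocation_def g_def outs_minus)
  moreover have "(\<integral>z. g z \<partial>(M \<Otimes>\<^sub>M M)) + (\<integral>(x, y). h (x, y, 0) + h (x, y, 1) \<partial>(M \<Otimes>\<^sub>M M))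
      = (\<integral>z. r z \<partial>(M \<Otimes>\<^sub>M M))"
    using chain by (subst Bochner_Integration.integral_add[OF int_g sum, symmetric])
      (auto intro!: Bochner_Integration.integral_cong simp: space_pair_measure)
  ultimately show ?thesis using int_r(2) by simp
qed

end

lemma ent_loss_eq: "ent_loss x z = x * (log 2 (x + z) - log 2 x) + z * (log 2 (z + x) - log 2 z)"
  by (simp add: ent_loss_def algebra_simps)

lemma ent_part_nonneg: "0 \<le> x \<Longrightarrow> 0 \<le> z \<Longrightarrow> 0 \<le> x * (log 2 (x + z) - log 2 x)"
  by (cases "x = 0") auto

lemma information_density_eq:
  assumes "0 \<le> x" "0 \<le> z"
  shows "1/2 * x * log 2 (1/2 * x / (1/2 * (1/2 * (x + z)))) = 1/2 * (x - x * (log 2 (x + z) - log 2 x))"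
proof (cases "x = 0")
  case False
  then have "0 < x" "0 < x + z" using assms by auto
  then have "log 2 (1/2 * x / (1/2 * (1/2 * (x + z)))) = log 2 (2 * x / (x + z))" by (simp add: field_simps)
  also have "\<dots> = 1 + log 2 x - log 2 (x + z)"
    using \<open>0 < x\<close> \<open>0 < x + z\<close> by (simp add: log_divide log_mult)
  finally show ?thesis by (simp only:) (simp add: algebra_simps)
qed simp

context binary_channel
begin

lemma capacity_eq: "capacity W = 1 - equivocation W"
proof -
  let ?S = "count_space (UNIV :: bit set)"
  define D where "D z = 1/2 * tprob W (fst z) (snd z)" for z
  interpret S: sigma_finite_measure ?S by (rule sigma_finite_bit)
  interpret P: pair_sigma_finite ?S M ..
  have D_meas [measurable]: "D \<in> borel_measurable (?S \<Otimes>\<^sub>M M)"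
  proof -
    have "(\<lambda>z. if fst z = 0 then a (snd z) else b (snd z)) \<in> borel_measurable (?S \<Otimes>\<^sub>M M)" by measurable
    moreover have "tprob W u y = (if u = 0 then a y else b y)" for u y using bit_cases[of u] by auto
    ultimately show ?thesis by (simp add: D_def[abs_def])
  qed
  have J: "joint_law W = density (?S \<Otimes>\<^sub>M M) (\<lambda>z. ennreal (D z))"
    unfolding joint_law_def D_def by (rule arg_cong[where f = "density _"]) auto
  have D_nonneg: "0 \<le> D (u, y)" if "y \<in> space M" for u y using that by (simp add: D_def tprob_nonneg)
  have half: "(\<integral>\<^sup>+ y. ennreal (D (u, y)) \<partial>M) = ennreal (1/2)" for u
    by (subst nn_integral_eq_integral) (auto simp: D_def tprob_nonneg)
  have "emeasure (joint_law W) (space (joint_law W)) = (\<integral>\<^sup>+ z. ennreal (D z) \<partial>(?S \<Otimes>\<^sub>M M))"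
    unfolding J by (simp add: emeasure_density cong: nn_integral_cong_simp)
  also have "\<dots> = (\<integral>\<^sup>+ u. \<integral>\<^sup>+ y. ennreal (D (u, y)) \<partial>M \<partial>?S)"
    by (rule nn_integral_fst [symmetric]) simp
  also have "\<dots> = 1"
  proof -
    have "(\<integral>\<^sup>+ u. c \<partial>?S) = c + c" for c by (simp add: UNIV_bit mult_2_right)
    then have "(\<integral>\<^sup>+ u. ennreal (1/2) \<partial>?S) = ennreal (1/2) + ennreal (1/2)" .
    also have "\<dots> = ennreal (1/2 + 1/2)" by (rule ennreal_plus [symmetric]) simp_all
    finally show ?thesis unfolding half by simp
  qed
  finally interpret J: prob_space "joint_law W" by (rule prob_spaceI)
  interpret J: information_space "joint_law W" 2 by standard simp
  have joint: "distributed (joint_law W) (?S \<Otimes>\<^sub>M M) (\<lambda>z. (fst z, snd z)) (\<lambda>z. ennreal (D z))"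
    unfolding distributed_def by (auto simp: J distr_id2)
  have out_density: "(\<integral>\<^sup>+ u. ennreal (D (u, y)) \<partial>?S) = ennreal (1/2 * (a y + b y))" if "y \<in> space M" for y
    using that by (simp add: nn_integral_count_space_finite UNIV_bit D_def tprob_nonneg flip: ennreal_plus)
  have inp: "distributed (joint_law W) ?S fst (\<lambda>_. ennreal (1/2))"
    using J.distr_marginal1[OF sigma_finite_bit sigma_finite joint] by (simp add: half)
  have "distributed (joint_law W) M snd (\<lambda>y. \<integral>\<^sup>+ u. ennreal (D (u, y)) \<partial>?S)"
    by (rule J.distr_marginal2[OF sigma_finite_bit sigma_finite joint])
  then have out: "distributed (joint_law W) M snd (\<lambda>y. ennreal (1/2 * (a y + b y)))"
    by (rule distributed_cong_density[THEN iffD1, rotated -1]) (auto simp: out_density)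
  define f where "f z = D z * log 2 (D z / (1/2 * (1/2 * (a (snd z) + b (snd z)))))" for z
  define k where "k u y = tprob W u y * (log 2 (tprob W u y + tprob W (u + 1) y) - log 2 (tprob W u y))" for u y
  have cap: "capacity W = integral\<^sup>L (?S \<Otimes>\<^sub>M M) f"
    unfolding capacity_def f_def
    by (rule J.mutual_information_distr[OF sigma_finite_bit sigma_finite inp _ out _ joint])
      (auto simp: tprob_nonneg D_nonneg)
  have k_bound: "0 \<le> k u y" "k u y \<le> ent_loss (a y) (b y)" if "y \<in> space M" for u y
  proof -
    have "0 \<le> k w y" for w using ent_part_nonneg tprob_nonneg[OF that] by (simp add: k_def)
    moreover have "ent_loss (a y) (b y) = k 0 y + k 1 y" by (simp add: k_def ent_loss_eq)
    ultimately show "0 \<le> k u y" "k u y \<le> ent_loss (a y) (b y)" using bit_cases[of u] by auto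
  qed
  have k_int: "integrable M (k u)" for u
  proof (rule Bochner_Integration.integrable_bound[OF integrable_ent_loss])
    show "k u \<in> borel_measurable M" unfolding k_def[abs_def] by measurable
    show "AE y in M. norm (k u y) \<le> norm (ent_loss (a y) (b y))"
    proof (rule AE_I2)
      fix y assume "y \<in> space M"
      from k_bound[OF this, of u] show "norm (k u y) \<le> norm (ent_loss (a y) (b y))" by simp
    qed
  qed
  have f_eq: "f (u, y) = 1/2 * (tprob W u y - k u y)" if "y \<in> space M" for u y
  proof -
    have "a y + b y = tprob W u y + tprob W (u + 1) y" using bit_cases[of u] by auto
    then show ?thesis
      using information_density_eq[OF tprob_nonneg[OF that] tprob_nonneg[OF that], of u "u + 1"]
      by (simp only: f_def D_def k_def fst_conv snd_conv)
  qed
  have f_int: "integrable M (\<lambda>y. f (u, y))" for u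
    by (subst Bochner_Integration.integrable_cong[OF refl f_eq]) (simp_all add: k_int)
  have "integrable (?S \<Otimes>\<^sub>M M) f"
  proof (rule P.Fubini_integrable)
    show "f \<in> borel_measurable (?S \<Otimes>\<^sub>M M)" unfolding f_def[abs_def] by measurable
  qed (auto simp: f_int UNIV_bit intro!: integrable_count_space)
  then have "capacity W = (\<integral>u. \<integral>y. f (u, y) \<partial>M \<partial>?S)" unfolding cap by (rule P.integral_fst' [symmetric])
  also have "\<dots> = (\<integral>y. f (0, y) \<partial>M) + (\<integral>y. f (1, y) \<partial>M)"
    by (simp add: lebesgue_integral_count_space_finite UNIV_bit)
  also have "\<dots> = (\<integral>y. f (0, y) + f (1, y) \<partial>M)" by (simp add: f_int)
  also have "\<dots> = (\<integral>y. 1/2 * (a y + b y - ent_loss (a y) (b y)) \<partial>M)"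
    by (intro Bochner_Integration.integral_cong) (simp_all add: f_eq k_def ent_loss_eq algebra_simps)
  also have "\<dots> = 1 - equivocation W" by (simp add: equivocation_def)
  finally show ?thesis .
qed

end

lemma inj_MinusOut: "inj (\<lambda>(y0, y1). MinusOut y0 y1)"
  by (auto simp: inj_def)

lemma inj_PlusOut: "inj (\<lambda>(y0, y1, u0). PlusOut y0 y1 u0)"
  by (auto simp: inj_def)

lemma inj_Leaf: "inj Leaf"
  by (auto simp: inj_def)

lemma binary_channel_synth:
  assumes "binary_channel W"
  shows "binary_channel (synth W m i)"
proof (induction m arbitrary: i)
  case 0
  then show ?case using assms by (simp add: binary_channel_relabel inj_Leaf)
next
  case (Suc m)
  then show ?case
    by (simp add: binary_channel_relabel inj_MinusOut inj_PlusOut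
        binary_channel.binary_channel_minus binary_channel.binary_channel_plus)
qed

lemma polarization_synth:
  assumes W: "binary_channel W" and "0 < capacity W" "capacity W < 1"
  shows "polarization (\<lambda>m i. equivocation (synth W m i)) (\<lambda>m i. overlap (synth W m i))
    (\<lambda>m i. variation (synth W m i))"
proof -
  note S = binary_channel_synth[OF W]
  note minus = binary_channel.binary_channel_minus[OF S] and plus = binary_channel.binary_channel_plus[OF S]
  interpret W: binary_channel W by (rule W)
  have H: "equivocation W = 1 - capacity W" using W.capacity_eq by simp
  show ?thesis
  proof
    fix m i
    show "variation (synth W (Suc m) (2 * i)) = (variation (synth W m i))\<^sup>2"
      by (simp add: variation_relabel[OF minus inj_MinusOut] binary_channel.variation_minus[OF S])
    show "variation (synth W (Suc m) (Suc (2 * i))) \<le> 2 * variation (synth W m i)"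
      "variation (synth W m i) \<le> variation (synth W (Suc m) (Suc (2 * i)))"
      by (simp_all add: variation_relabel[OF plus inj_PlusOut] binary_channel.variation_plus_le[OF S]
          binary_channel.variation_plus_ge[OF S])
    show "overlap (synth W (Suc m) (Suc (2 * i))) = (overlap (synth W m i))\<^sup>2"
      by (simp add: overlap_relabel[OF plus inj_PlusOut] binary_channel.overlap_plus[OF S])
    show "overlap (synth W (Suc m) (2 * i)) \<le> 2 * overlap (synth W m i)"
      "overlap (synth W m i) \<le> overlap (synth W (Suc m) (2 * i))"
      by (simp_all add: overlap_relabel[OF minus inj_MinusOut] binary_channel.overlap_minus_le[OF S]
          binary_channel.overlap_minus_ge[OF S])
    show "equivocation (synth W (Suc m) (2 * i)) + equivocation (synth W (Suc m) (Suc (2 * i)))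
        = 2 * equivocation (synth W m i)"
      by (simp add: equivocation_relabel[OF minus inj_MinusOut] equivocation_relabel[OF plus inj_PlusOut]
          binary_channel.equivocation_split[OF S])
    show "0 < overlap (synth W 0 0)"
      using W.equivocation_le H assms(3) by (simp add: overlap_relabel[OF W inj_Leaf])
    show "0 < variation (synth W 0 0)"
      using W.equivocation_ge H assms(2) by (simp add: variation_relabel[OF W inj_Leaf])
  qed (rule binary_channel.overlap_nonneg[OF S] binary_channel.variation_nonneg[OF S]
      binary_channel.variation_overlap_ge_1[OF S] binary_channel.equivocation_ge[OF S]
      binary_channel.equivocation_le[OF S] binary_channel.equivocation_le_mean[OF S]
      binary_channel.overlap_le[OF S] binary_channel.variation_le[OF S])+
qed

section \<open>Bit permutations as affine automorphisms\<close>

lemma sum_lessThan_add: "(\<Sum>l<n + k. f l) = (\<Sum>l<n. f l) + (\<Sum>l<k. f (n + l))"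
  for f :: "nat \<Rightarrow> 'a :: comm_monoid_add"
  by (induction k) (simp_all add: add.assoc)

lemma bit_mult_add:
  assumes "y < 2 ^ n"
  shows "bit (x * 2 ^ n + y :: nat) r \<longleftrightarrow> (if r < n then bit y r else bit x (r - n))"
proof (cases "r < n")
  case True
  then have "bit (x * 2 ^ n + y) r \<longleftrightarrow> bit (take_bit n (x * 2 ^ n + y)) r"
    by (simp add: bit_take_bit_iff)
  also have "take_bit n (x * 2 ^ n + y) = y" using assms by (simp add: take_bit_eq_mod)
  finally show ?thesis using True by simp
next
  case False
  then have "bit (x * 2 ^ n + y) r \<longleftrightarrow> bit (drop_bit n (x * 2 ^ n + y)) (r - n)"
    by (simp add: bit_drop_bit_eq)
  also have "drop_bit n (x * 2 ^ n + y) = x" using assms by (simp add: drop_bit_eq_div)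
  finally show ?thesis using False by simp
qed

lemma bit_less_exp: "bit (i :: nat) r \<Longrightarrow> i < 2 ^ m \<Longrightarrow> r < m"
  by (rule ccontr) (auto simp: bit_iff_odd not_less dest!: power_increasing[of m r "2 :: nat"])

lemma dim_polar_mat [simp]: "dim_row (polar_mat m) = 2 ^ m" "dim_col (polar_mat m) = 2 ^ m"
  by (induction m) (simp_all add: kronecker_def mat_of_rows_list_def)

lemma polar_mat_Suc:
  assumes "s < 2" "t < 2" "i < 2 ^ m" "j < 2 ^ m"
  shows "polar_mat (Suc m) $$ (s * 2 ^ m + i, t * 2 ^ m + j) = (if t \<le> s then polar_mat m $$ (i, j) else 0)"
proof -
  have bound: "u * 2 ^ m + k < 2 * 2 ^ m" if "u < 2" "k < 2 ^ m" for u k :: nat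
    using that by (cases u) auto
  have "mat_of_rows_list 2 [[1, 0], [1, 1]] $$ (s, t) = (if t \<le> s then 1 else 0 :: bit)"
    using assms(1,2) by (auto simp: mat_of_rows_list_def less_2_cases_iff)
  then show ?thesis
    using assms bound[of s i] bound[of t j] by (simp add: kronecker_def mat_of_rows_list_def)
qed

lemma nat_less_exp_SucE:
  assumes "i < (2::nat) ^ Suc m"
  obtains s i' where "i = s * 2 ^ m + i'" "s < 2" "i' < 2 ^ m"
proof -
  have "i = i div 2 ^ m * 2 ^ m + i mod 2 ^ m" by (simp only: div_mult_mod_eq)
  moreover have "i div 2 ^ m < 2" using assms by (simp add: div_less_iff_less_mult mult.commute)
  ultimately show thesis using that[of "i div 2 ^ m" "i mod 2 ^ m"] by simp
qed

lemma polar_mat_index: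
  assumes "i < 2 ^ m" "j < 2 ^ m"
  shows "polar_mat m $$ (i, j) = (if \<forall>r. bit j r \<longrightarrow> bit i r then 1 else 0)"
  using assms
proof (induction m arbitrary: i j)
  case (Suc m)
  obtain s i' where i: "i = s * 2 ^ m + i'" "s < 2" "i' < 2 ^ m" using Suc.prems(1) by (rule nat_less_exp_SucE)
  obtain t j' where j: "j = t * 2 ^ m + j'" "t < 2" "j' < 2 ^ m" using Suc.prems(2) by (rule nat_less_exp_SucE)
  have small: "bit u q \<longleftrightarrow> q = 0 \<and> u = 1" if "u < 2" for u q :: nat
    using that by (cases q) (auto simp: less_2_cases_iff bit_iff_odd div_mult2_eq)
  have "(\<forall>r. bit j r \<longrightarrow> bit i r) \<longleftrightarrow> (\<forall>r. bit j' r \<longrightarrow> bit i' r) \<and> t \<le> s"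
  proof
    assume *: "\<forall>r. bit j r \<longrightarrow> bit i r"
    have "bit i' r" if "bit j' r" for r
      using *[rule_format, of r] that bit_less_exp[OF that j(3)] by (simp add: i j bit_mult_add)
    moreover have "t \<le> s"
      using *[rule_format, of m] i(2) j(2) by (auto simp: i(1,3) j(1,3) bit_mult_add small less_2_cases_iff)
    ultimately show "(\<forall>r. bit j' r \<longrightarrow> bit i' r) \<and> t \<le> s" by blast
  next
    assume "(\<forall>r. bit j' r \<longrightarrow> bit i' r) \<and> t \<le> s"
    then show "\<forall>r. bit j r \<longrightarrow> bit i r"
      using i(2) j(2) by (auto simp: i(1,3) j(1,3) bit_mult_add small less_2_cases_iff)
  qed
  then show ?case
    using Suc.IH[OF i(3) j(3)] polar_mat_Suc[OF i(2) j(2) i(3) j(3)] by (simp add: i(1) j(1))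
qed simp

lemma polar_mat_square:
  assumes "i < 2 ^ m" "j < 2 ^ m"
  shows "(\<Sum>l<2 ^ m. polar_mat m $$ (i, l) * polar_mat m $$ (l, j)) = (if i = j then 1 else 0)"
  using assms
proof (induction m arbitrary: i j)
  case (Suc m)
  obtain s i' where i: "i = s * 2 ^ m + i'" "s < 2" "i' < 2 ^ m" using Suc.prems(1) by (rule nat_less_exp_SucE)
  obtain t j' where j: "j = t * 2 ^ m + j'" "t < 2" "j' < 2 ^ m" using Suc.prems(2) by (rule nat_less_exp_SucE)
  have eq: "i = j \<longleftrightarrow> s = t \<and> i' = j'"
  proof
    assume "i = j"
    then have "i div 2 ^ m = j div 2 ^ m" "i mod 2 ^ m = j mod 2 ^ m" by simp_all
    then show "s = t \<and> i' = j'" using i(3) j(3) by (simp add: i(1) j(1))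
  qed (simp add: i(1) j(1))
  have part: "(\<Sum>l<2 ^ m. polar_mat (Suc m) $$ (i, u * 2 ^ m + l) * polar_mat (Suc m) $$ (u * 2 ^ m + l, j))
      = (if u \<le> s \<and> t \<le> u \<and> i' = j' then 1 else 0)" if "u < 2" for u
  proof -
    have "(\<Sum>l<2 ^ m. polar_mat (Suc m) $$ (i, u * 2 ^ m + l) * polar_mat (Suc m) $$ (u * 2 ^ m + l, j))
        = (\<Sum>l<2 ^ m. if u \<le> s \<and> t \<le> u then polar_mat m $$ (i', l) * polar_mat m $$ (l, j') else 0)"
      using i j that by (intro sum.cong) (simp_all add: polar_mat_Suc del: polar_mat.simps)
    also have "\<dots> = (if u \<le> s \<and> t \<le> u then if i' = j' then 1 else 0 else 0)"
      unfolding Suc.IH[OF i(3) j(3), symmetric] by (cases "u \<le> s \<and> t \<le> u") (simp_all only: if_True if_False sum.neutral_const simp_thms)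
    finally show ?thesis by (simp only: if_bool_eq_conj) auto
  qed
  define f where "f l = polar_mat (Suc m) $$ (i, l) * polar_mat (Suc m) $$ (l, j)" for l
  have "(\<Sum>l<2 ^ Suc m. f l) = (\<Sum>l<2 ^ m. f (0 * 2 ^ m + l)) + (\<Sum>l<2 ^ m. f (1 * 2 ^ m + l))"
    by (simp only: power_Suc mult_2 sum_lessThan_add mult_0 add_0 mult_1)
  also have "\<dots> = (if 0 \<le> s \<and> t \<le> 0 \<and> i' = j' then 1 else 0) + (if 1 \<le> s \<and> t \<le> 1 \<and> i' = j' then 1 else 0)"
    unfolding f_def using part[of 0] part[of 1] by (intro arg_cong2[where f = "(+)"]) (simp_all only: one_less_numeral_iff zero_less_numeral semiring_norm)
  also have "\<dots> = (if i = j then 1 else 0)"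
    using i(2) j(2) by (auto simp: eq less_2_cases_iff)
  finally show ?case by (simp only: f_def)
qed simp

lemma row_in_polar_code_iff:
  assumes "j < 2 ^ m"
  shows "row (polar_mat m) j \<in> polar_code m F \<longleftrightarrow> j \<notin> F"
proof -
  interpret V: vec_space "TYPE(bit)" "2 ^ m" .
  define S where "S = {row (polar_mat m) i | i. i \<in> {..<2 ^ m} - F}"
  have S: "S \<subseteq> carrier_vec (2 ^ m)" by (auto simp: S_def intro!: carrier_vecI)
  have code: "polar_code m F = V.span S" by (simp add: polar_code_def S_def)
  define \<mu> where "\<mu> v = (\<Sum>l<2 ^ m. v $ l * polar_mat m $$ (l, j))" for v :: "bit vec"
  have \<mu>_row: "\<mu> (row (polar_mat m) i) = (if i = j then 1 else 0)" if "i < 2 ^ m" for i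
    using polar_mat_square[OF that assms] that by (simp add: \<mu>_def)
  show ?thesis
  proof
    assume "row (polar_mat m) j \<in> polar_code m F"
    then have "row (polar_mat m) j \<in> V.span S" by (simp only: code)
    from V.in_spanE[OF this] obtain c A
      where A: "finite A" "A \<subseteq> S" "row (polar_mat m) j = V.lincomb c A" by (elim exE conjE) (rule that)
    have idx: "V.lincomb c A $ l = (\<Sum>x\<in>A. c x * x $ l)" if "l < 2 ^ m" for l
      using that A(2) S by (intro V.lincomb_index) auto
    have "\<mu> (V.lincomb c A) = (\<Sum>l<2 ^ m. (\<Sum>x\<in>A. c x * x $ l) * polar_mat m $$ (l, j))"
      unfolding \<mu>_def by (intro sum.cong refl) (simp only: idx lessThan_iff)
    also have "\<dots> = (\<Sum>l<2 ^ m. \<Sum>x\<in>A. c x * (x $ l * polar_mat m $$ (l, j)))"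
      by (simp only: sum_distrib_right mult.assoc)
    also have "\<dots> = (\<Sum>x\<in>A. c x * \<mu> x)"
      unfolding \<mu>_def sum_distrib_left by (rule sum.swap)
    finally have "(\<Sum>x\<in>A. c x * \<mu> x) = 1" using A(3) \<mu>_row[OF assms] by simp
    then have "(\<Sum>x\<in>A. c x * \<mu> x) \<noteq> 0" by simp
    then obtain x where x: "x \<in> A" "c x * \<mu> x \<noteq> 0" by (rule sum.not_neutral_contains_not_neutral)
    then have "x \<in> S" using A(2) by blast
    then obtain i where i: "x = row (polar_mat m) i" "i < 2 ^ m" "i \<notin> F" unfolding S_def by blast
    have "i = j"
    proof (rule ccontr)
      assume "i \<noteq> j"
      then have "\<mu> x = 0" unfolding i(1) \<mu>_row[OF i(2)] by (rule if_not_P)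
      with x(2) show False by simp
    qed
    with i(3) show "j \<notin> F" by simp
  next
    assume "j \<notin> F"
    then have "row (polar_mat m) j \<in> S" using assms by (auto simp: S_def)
    then show "row (polar_mat m) j \<in> polar_code m F"
      unfolding code by (intro V.span_mem S)
  qed
qed

lemma bit_sum_exp: "bit (\<Sum>k<n. if P k then 2 ^ k else 0 :: nat) r \<longleftrightarrow> r < n \<and> P r"
proof -
  have "(\<Sum>k<n. if P k then 2 ^ k else 0 :: nat) = horner_sum of_bool 2 (map P [0..<n])"
    unfolding horner_sum_eq_sum by (intro sum.cong) auto
  then show ?thesis by (auto simp: bit_horner_sum_bit_iff)
qed

definition position_mat :: "nat \<Rightarrow> (nat \<Rightarrow> nat) \<Rightarrow> bit mat" where
  "position_mat m \<sigma> = mat m m (\<lambda>(r, c). if c = \<sigma> r then 1 else 0)"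

lemma bit_affine_position_mat:
  assumes "\<And>r. r < m \<Longrightarrow> \<sigma> r < m"
  shows "bit (affine_map m (position_mat m \<sigma>) (0\<^sub>v m) i) r \<longleftrightarrow> r < m \<and> bit i (\<sigma> r)"
proof -
  have "(position_mat m \<sigma> *\<^sub>v bits_of_nat m i + 0\<^sub>v m) $ r = of_nat (i div 2 ^ \<sigma> r)" if "r < m" for r
  proof -
    have "(position_mat m \<sigma> *\<^sub>v bits_of_nat m i + 0\<^sub>v m) $ r
        = (\<Sum>c = 0..<m. (if c = \<sigma> r then 1 else 0) * of_nat (i div 2 ^ c))"
      using that by (simp add: position_mat_def bits_of_nat_def scalar_prod_def)
    also have "\<dots> = (\<Sum>c = 0..<m. if c = \<sigma> r then of_nat (i div 2 ^ c) else 0)"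
      by (intro sum.cong) auto
    also have "\<dots> = of_nat (i div 2 ^ \<sigma> r)" using assms[OF that] by simp
    finally show ?thesis .
  qed
  moreover have "(of_nat n :: bit) = 1 \<longleftrightarrow> odd n" for n by (induction n) auto
  moreover have "dim_vec (position_mat m \<sigma> *\<^sub>v bits_of_nat m i + 0\<^sub>v m) = m" by simp
  ultimately show ?thesis
    unfolding affine_map_def nat_of_bits_def bit_sum_exp by (auto simp: bit_iff_odd)
qed

lemma position_mat_involution:
  assumes "\<And>r. r < m \<Longrightarrow> \<sigma> r < m" and "\<And>r. \<sigma> (\<sigma> r) = r"
  shows "invertible_mat (position_mat m \<sigma>)"
proof -
  have "position_mat m \<sigma> * position_mat m \<sigma> = 1\<^sub>m m"
  proof (rule eq_matI)
    fix r c assume rc: "r < dim_row (1\<^sub>m m)" "c < dim_col (1\<^sub>m m :: bit mat)"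
    then have "(position_mat m \<sigma> * position_mat m \<sigma>) $$ (r, c)
        = (\<Sum>k = 0..<m. (if k = \<sigma> r then 1 else 0) * (if c = \<sigma> k then 1 else 0))"
      by (simp add: position_mat_def scalar_prod_def)
    also have "\<dots> = (\<Sum>k = 0..<m. if k = \<sigma> r then (if c = \<sigma> (\<sigma> r) then 1 else 0) else 0)"
      by (intro sum.cong) auto
    finally show "(position_mat m \<sigma> * position_mat m \<sigma>) $$ (r, c) = 1\<^sub>m m $$ (r, c)"
      using rc assms by auto
  qed (simp_all add: position_mat_def)
  then show ?thesis
    by (auto simp: invertible_mat_def inverts_mat_def position_mat_def intro!: exI[of _ "position_mat m \<sigma>"])
qed

text \<open>Permuting the positions maps the row with index \<open>i\<close> to the row whose index is \<open>i\<close> with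
  permuted bits, and the rows are linearly independent.\<close>

lemma unfrozen_affine_image:
  assumes \<sigma>: "\<And>r. r < m \<Longrightarrow> \<sigma> r < m" "\<And>r. \<sigma> (\<sigma> r) = r"
    and inv: "code_invariant (2 ^ m) (polar_code m F) (affine_map m (position_mat m \<sigma>) (0\<^sub>v m))"
    and i: "i < 2 ^ m" "i \<notin> F"
  shows "affine_map m (position_mat m \<sigma>) (0\<^sub>v m) i \<notin> F"
proof -
  define \<pi> where "\<pi> = affine_map m (position_mat m \<sigma>) (0\<^sub>v m)"
  have bit: "bit (\<pi> j) r \<longleftrightarrow> r < m \<and> bit j (\<sigma> r)" for j r
    unfolding \<pi>_def by (rule bit_affine_position_mat[OF \<sigma>(1)])
  have lt: "\<pi> j < 2 ^ m" for j
  proof -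
    have "take_bit m (\<pi> j) = \<pi> j" by (rule bit_eqI) (auto simp: bit_take_bit_iff bit)
    then show ?thesis using take_bit_nat_less_exp[of m "\<pi> j"] by simp
  qed
  have "vec (2 ^ m) (\<lambda>j. row (polar_mat m) i $ \<pi> j) = row (polar_mat m) (\<pi> i)"
  proof (rule eq_vecI)
    fix j assume "j < dim_vec (row (polar_mat m) (\<pi> i))"
    then have j: "j < 2 ^ m" by simp
    have "(\<forall>r. bit (\<pi> j) r \<longrightarrow> bit i r) \<longleftrightarrow> (\<forall>r. bit j r \<longrightarrow> bit (\<pi> i) r)"
      unfolding bit using \<sigma> bit_less_exp[OF _ j] bit_less_exp[OF _ i(1)] by metis
    then show "vec (2 ^ m) (\<lambda>j. row (polar_mat m) i $ \<pi> j) $ j = row (polar_mat m) (\<pi> i) $ j"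
      using i(1) j lt by (simp add: polar_mat_index)
  qed simp
  moreover have "row (polar_mat m) i \<in> polar_code m F" using i by (simp add: row_in_polar_code_iff)
  ultimately have "row (polar_mat m) (\<pi> i) \<in> polar_code m F"
    using inv unfolding code_invariant_def \<pi>_def[symmetric] by metis
  then show ?thesis using row_in_polar_code_iff[OF lt] by (simp add: \<pi>_def)
qed

lemma sum_list_take_mono: "i \<le> j \<Longrightarrow> sum_list (take i s) \<le> (sum_list (take j s) :: nat)"
  by (auto simp: le_iff_add take_add)

lemma sum_list_take_le: "sum_list (take i s) \<le> (sum_list s :: nat)"
  using sum_list_append[of "take i s" "drop i s"] by simp

lemma position_mat_in_BLTA:
  assumes \<sigma>: "\<And>r. r < m \<Longrightarrow> \<sigma> r < m" "\<And>r. \<sigma> (\<sigma> r) = r"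
    and s: "sum_list s = m" "p < length s"
    and block: "\<And>r. \<sigma> r \<noteq> r \<Longrightarrow> r \<in> block_range s p"
  shows "affine_map m (position_mat m \<sigma>) (0\<^sub>v m) \<in> BLTA s m"
proof -
  have disjoint: "r < c" if "u < v" "r \<in> block_range s u" "c \<in> block_range s v" for u v r c
    using that(2,3) sum_list_take_mono[of "Suc u" v s] that(1) unfolding block_range_def atLeastLessThan_iff by linarith
  have "block_lower_triangular s (position_mat m \<sigma>)"
    unfolding block_lower_triangular_def
  proof (intro allI impI ballI)
    fix v u r c assume uv: "v < length s" "u < v" and r: "r \<in> block_range s u" and c: "c \<in> block_range s v"
    have "c \<noteq> \<sigma> r"
    proof
      assume "c = \<sigma> r"
      then have "\<sigma> r \<noteq> r" "\<sigma> c \<noteq> c" using disjoint[OF uv(2) r c] \<sigma>(2)[of r] by auto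
      then have "r \<in> block_range s p" "c \<in> block_range s p" by (simp_all add: block)
      then show False
        using disjoint[of u p r r] disjoint[of p u r r] disjoint[of v p c c] disjoint[of p v c c] r c uv(2)
        by (cases u p rule: linorder_cases; cases v p rule: linorder_cases) auto
    qed
    moreover have "r < m" "c < m"
      using r c sum_list_take_le[of "Suc u" s] sum_list_take_le[of "Suc v" s] s(1) by (simp_all add: block_range_def)
    ultimately show "position_mat m \<sigma> $$ (r, c) = 0" by (simp add: position_mat_def)
  qed
  moreover have "position_mat m \<sigma> \<in> carrier_mat m m" by (simp add: position_mat_def)
  ultimately show ?thesis
    unfolding BLTA_def mem_Collect_eq using position_mat_involution[OF \<sigma>]
    by (intro exI[of _ "position_mat m \<sigma>"] exI[of _ "0\<^sub>v m"]) simp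
qed

definition swap_runs :: "nat \<Rightarrow> nat \<Rightarrow> nat \<Rightarrow> nat" where
  "swap_runs L k r = (if L \<le> r \<and> r < L + k then r + k else if L + k \<le> r \<and> r < L + 2 * k then r - k else r)"

lemma swap_runs_involution: "swap_runs L k (swap_runs L k r) = r"
  by (auto simp: swap_runs_def)

lemma affine_swap_runs:
  assumes L: "L + 2 * k \<le> m" and p: "p < 2 ^ (m - 2 * k - L)" and q: "q < 2 ^ L"
  shows "affine_map m (position_mat m (swap_runs L k)) (0\<^sub>v m) (((p * 2 ^ k + (2 ^ k - 1)) * 2 ^ k) * 2 ^ L + q)
    = ((p * 2 ^ k) * 2 ^ k + (2 ^ k - 1)) * 2 ^ L + q" (is "_ = ?bad")
proof (rule bit_eqI)
  fix r
  have kk: "(2::nat) ^ k - 1 < 2 ^ k" by simp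
  have ones: "bit (2 ^ k - 1 :: nat) r \<longleftrightarrow> r < k" for r
    using bit_mask_iff[of k r, where 'a = nat] by (simp add: mask_eq_exp_minus_1)
  have zeros: "bit (x * 2 ^ k :: nat) r \<longleftrightarrow> k \<le> r \<and> bit x (r - k)" for x r
    using bit_mult_add[of 0 k x r] by simp
  have good: "bit (((p * 2 ^ k + (2 ^ k - 1)) * 2 ^ k) * 2 ^ L + q) r \<longleftrightarrow>
      (if r < L then bit q r else L + k \<le> r \<and> (if r < L + 2 * k then True else bit p (r - L - 2 * k)))" for r
    unfolding bit_mult_add[OF q] zeros bit_mult_add[OF kk] ones by (auto simp: mult_2 add.assoc)
  have bad: "bit ?bad r \<longleftrightarrow>
      (if r < L then bit q r else r < L + k \<or> L + 2 * k \<le> r \<and> bit p (r - L - 2 * k))" for r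
    unfolding bit_mult_add[OF q] bit_mult_add[OF kk] zeros ones by (auto simp: mult_2 add.assoc)
  have high: "r < m" if "bit p (r - L - 2 * k)" "L + 2 * k \<le> r"
    using bit_less_exp[OF that(1) p] that(2) L by linarith
  have \<sigma>: "swap_runs L k r < m" if "r < m" for r using that L by (auto simp: swap_runs_def)
  have aff: "bit (affine_map m (position_mat m (swap_runs L k)) (0\<^sub>v m) i) r
      \<longleftrightarrow> r < m \<and> bit i (swap_runs L k r)" for i
    by (rule bit_affine_position_mat) (rule \<sigma>)
  consider "r < L" | "L \<le> r" "r < L + k" | "L + k \<le> r" "r < L + 2 * k" | "L + 2 * k \<le> r" by linarith
  then show "bit (affine_map m (position_mat m (swap_runs L k)) (0\<^sub>v m)
      (((p * 2 ^ k + (2 ^ k - 1)) * 2 ^ k) * 2 ^ L + q)) r \<longleftrightarrow> bit ?bad r"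
  proof cases
    case 1
    then show ?thesis using L unfolding aff good bad by (simp add: swap_runs_def)
  next
    case 2
    then show ?thesis using L unfolding aff good bad by (simp add: swap_runs_def)
  next
    case 3
    then have "\<not> r - k < L" "\<not> L + k \<le> r - k" by linarith+
    then show ?thesis using 3 L unfolding aff good bad by (simp add: swap_runs_def)
  next
    case 4
    then show ?thesis using high[OF _ 4] unfolding aff good bad by (auto simp: swap_runs_def)
  qed
qed

section \<open>Growing blocks\<close>

theorem theorem1:
  fixes W :: "'y channel" and F :: "nat \<Rightarrow> nat set"
  assumes "bms_channel W"
    and "0 < capacity W" and "capacity W < 1"
    and "\<And>m. 1 \<le> m \<Longrightarrow> polar_frozen_set W m (F m)"
  shows "\<not> (\<exists>(s :: nat \<Rightarrow> nat list) (i :: nat \<Rightarrow> nat).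
            (\<forall>m\<ge>1. (\<forall>k\<in>set (s m). 0 < k) \<and> sum_list (s m) = m \<and> i m < length (s m) \<and>
                    (\<forall>\<pi>\<in>BLTA (s m) m. code_invariant (2 ^ m) (polar_code m (F m)) \<pi>)) \<and>
            mono_on {1..} (\<lambda>m. s m ! i m) \<and>
            (\<forall>B. \<exists>m\<ge>1. B < s m ! i m))"
proof
  assume "\<exists>s i. (\<forall>m\<ge>1. (\<forall>k\<in>set (s m). 0 < k) \<and> sum_list (s m) = m \<and> i m < length (s m) \<and>
      (\<forall>\<pi>\<in>BLTA (s m) m. code_invariant (2 ^ m) (polar_code m (F m)) \<pi>)) \<and>
    mono_on {1..} (\<lambda>m. s m ! i m) \<and> (\<forall>B. \<exists>m\<ge>1. B < s m ! i m)"
  then obtain s i where all: "\<forall>m\<ge>1. (\<forall>k\<in>set (s m). 0 < k) \<and> sum_list (s m) = m \<and> i m < length (s m) \<and>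
      (\<forall>\<pi>\<in>BLTA (s m) m. code_invariant (2 ^ m) (polar_code m (F m)) \<pi>)"
    and mono: "mono_on {1..} (\<lambda>m. s m ! i m)" and unbounded: "\<forall>B. \<exists>m\<ge>1. B < s m ! i m"
    by (elim exE conjE) (rule that)
  have s: "sum_list (s m) = m" "i m < length (s m)" if "1 \<le> m" for m
    using all that by simp_all
  have inv: "code_invariant (2 ^ m) (polar_code m (F m)) \<pi>" if "1 \<le> m" "\<pi> \<in> BLTA (s m) m" for m \<pi>
    using all that by simp
  have W: "binary_channel W" by (rule bms_imp_binary_channel[OF assms(1)])
  interpret polarization "\<lambda>m i. equivocation (synth W m i)" "\<lambda>m i. overlap (synth W m i)"
    "\<lambda>m i. variation (synth W m i)"
    by (rule polarization_synth[OF W assms(2,3)])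
  have equiv0: "equivocation (synth W 0 0) = 1 - capacity W"
    using binary_channel.capacity_eq[OF W] by (simp add: equivocation_relabel[OF W inj_Leaf])
  have variation: "variation (synth W m i) = 1 - 2 * sc_error W m i" for m i
    unfolding sc_error_def by (rule binary_channel.variation_eq[OF binary_channel_synth[OF W]])
  have "\<exists>c>0. c \<le> 1 \<and> (\<forall>m0. \<exists>m\<ge>m0. \<forall>i<2 ^ m. (1 - c < variation (synth W m i) \<longrightarrow> i \<notin> F m) \<and>
      (variation (synth W m i) < c \<longrightarrow> i \<in> F m))"
  proof (rule threshold)
    fix m :: nat assume "1 \<le> m"
    note F = assms(4)[OF this, unfolded polar_frozen_set_def]
    show "F m \<subseteq> {..<2 ^ m}" using F by simp
    define x where "x = 2 ^ m * (1 - capacity W)"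
    have "int (card (F m)) = \<lfloor>x\<rfloor> \<or> int (card (F m)) = \<lceil>x\<rceil>" using F by (simp add: x_def)
    then have "real (card (F m)) = of_int \<lfloor>x\<rfloor> \<or> real (card (F m)) = of_int \<lceil>x\<rceil>" by (metis of_int_of_nat_eq)
    then have "\<bar>real (card (F m)) - x\<bar> \<le> 1" by (elim disjE) linarith+
    then show "\<bar>real (card (F m)) - 2 ^ m * equivocation (synth W 0 0)\<bar> \<le> 1" by (simp only: x_def equiv0)
    show "variation (synth W m i) \<le> variation (synth W m j)" if "i \<in> F m" "j < 2 ^ m" "j \<notin> F m" for i j
      using F that by (simp add: variation)
  qed
  then obtain c where c: "0 < c" "c \<le> 1" and thr: "\<And>m0. \<exists>m\<ge>m0. \<forall>i<2 ^ m.
      (1 - c < variation (synth W m i) \<longrightarrow> i \<notin> F m) \<and> (variation (synth W m i) < c \<longrightarrow> i \<in> F m)"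
    by blast
  obtain k where k: "\<And>m F L. (\<And>i. i < 2 ^ m \<Longrightarrow> (1 - c < variation (synth W m i) \<longrightarrow> i \<notin> F) \<and>
      (variation (synth W m i) < c \<longrightarrow> i \<in> F)) \<Longrightarrow>
    L + 2 * k \<le> m \<Longrightarrow> \<exists>p<2 ^ (m - 2 * k - L). \<exists>q<2 ^ L.
       ((p * 2 ^ k + (2 ^ k - 1)) * 2 ^ k) * 2 ^ L + q \<notin> F \<and>
       ((p * 2 ^ k) * 2 ^ k + (2 ^ k - 1)) * 2 ^ L + q \<in> F"
    using block_separation[OF c] by blast
  obtain m0 where m0: "1 \<le> m0" "2 * k < s m0 ! i m0" using unbounded by blast
  obtain m where m: "m0 \<le> m" and thr_m: "\<And>i. i < 2 ^ m \<Longrightarrow>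
      (1 - c < variation (synth W m i) \<longrightarrow> i \<notin> F m) \<and> (variation (synth W m i) < c \<longrightarrow> i \<in> F m)"
    using thr by blast
  have m1: "1 \<le> m" using m m0(1) by simp
  note sm = s[OF m1]
  have size: "2 * k < s m ! i m"
    using mono_onD[OF mono, of m0 m] m0 m by simp
  define a where "a = sum_list (take (i m) (s m))"
  define L where "L = a + s m ! i m - 2 * k"
  have block: "block_range (s m) (i m) = {a..<a + s m ! i m}"
    using sm(2) by (simp add: block_range_def a_def take_Suc_conv_app_nth)
  have "a + s m ! i m \<le> m"
    using sum_list_take_le[of "Suc (i m)" "s m"] sm by (simp add: a_def take_Suc_conv_app_nth)
  then have L: "L + 2 * k \<le> m" "a \<le> L" "L + 2 * k = a + s m ! i m" using size by (auto simp: L_def)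
  define \<sigma> where "\<sigma> = swap_runs L k"
  have \<sigma>: "r < m \<Longrightarrow> \<sigma> r < m" "\<sigma> (\<sigma> r) = r" for r
    using L(1) by (auto simp: \<sigma>_def swap_runs_involution) (auto simp: swap_runs_def)
  have "\<sigma> r \<noteq> r \<Longrightarrow> r \<in> block_range (s m) (i m)" for r
    using L(2,3) by (auto simp: \<sigma>_def swap_runs_def block split: if_splits)
  then have "affine_map m (position_mat m \<sigma>) (0\<^sub>v m) \<in> BLTA (s m) m"
    by (intro position_mat_in_BLTA[OF \<sigma> sm])
  then have unfrozen: "affine_map m (position_mat m \<sigma>) (0\<^sub>v m) j \<notin> F m" if "j < 2 ^ m" "j \<notin> F m" for j
    by (intro unfrozen_affine_image[OF \<sigma> inv[OF m1] that])
  obtain p q where pq: "p < 2 ^ (m - 2 * k - L)" "q < 2 ^ L"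
    and sep: "((p * 2 ^ k + (2 ^ k - 1)) * 2 ^ k) * 2 ^ L + q \<notin> F m"
      "((p * 2 ^ k) * 2 ^ k + (2 ^ k - 1)) * 2 ^ L + q \<in> F m"
    using k[OF thr_m L(1)] by blast
  have "((p * 2 ^ k + (2 ^ k - 1)) * 2 ^ k) * 2 ^ L + q < 2 ^ m"
  proof -
    have "p * 2 ^ k + (2 ^ k - 1) < 2 ^ (m - 2 * k - L) * 2 ^ k" by (rule digits_bound[OF pq(1)]) simp
    then have "(p * 2 ^ k + (2 ^ k - 1)) * 2 ^ k < 2 ^ (m - 2 * k - L) * 2 ^ k * 2 ^ k" by simp
    from digits_bound[OF this pq(2)] show ?thesis
      using L(1) by (simp add: power_add [symmetric] mult.assoc)
  qed
  from unfrozen[OF this sep(1)] show False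
    using sep(2) affine_swap_runs[OF L(1) pq] by (simp add: \<sigma>_def)
qed

end
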